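(* Suppose $d=d_n$ and $\delta=\delta_n$ satisfy $d=\Theta(1/\delta^2)$ (constant edge density) and $d\gg n^{2.5}$. Then, as $n\to\infty$, $$d_{TV}\Big(\mathrm{RIG}(n,d,\delta),\ \mathrm{RGT}\big(n,\,1-e^{-d\delta^2+(n-2)d\delta^3(1-\delta)^{n-3}},\,1-e^{-d\delta^3(1-\delta)^{n-3}}\big)\Big)=o(1).$$
   Context: $\mathrm{RIG}(n,d,\delta)$ (random intersection graph): sample $n$ sets $S_1,\dots,S_n\subset[d]$, where each $S_i$ includes each element of $[d]$ independently with probability $\delta$; vertices $i\ne j$ of the graph on $[n]$ are connected if and only if $S_i\cap S_j\neq\emptyset$. $\mathrm{RGT}(n,p,p')$ (random graph with triangles): sample an Erdős–Rényi graph $G(n,p)$ and then, independently for each triple of vertices, with probability $p'$ add the three edges of the triangle on that triple. $d\gg n^{2.5}$ means $d/n^{2.5}\to\infty$. $d_{TV}$ is total variation distance. *)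

theory Defs
  imports "HOL-Probability.Probability" "HOL-Library.Landau_Symbols" "HOL-Library.Ramsey"
begin

text \<open>
  A graph on the vertex set \<open>{1..n}\<close> is identified with its edge set, a subset of
  \<open>nsets {1..n} 2\<close>, the set of two-element subsets of \<open>{1..n}\<close>.
\<close>

definition tv_dist :: "'a pmf \<Rightarrow> 'a pmf \<Rightarrow> real" where
  "tv_dist P Q = (SUP A. \<bar>measure_pmf.prob P A - measure_pmf.prob Q A\<bar>)"

text \<open>
  The random subset of a finite set \<open>A\<close> that contains each element of \<open>A\<close> independently with
  probability \<open>p\<close>. Note that \<^const>\<open>bernoulli_pmf\<close> clamps its parameter to \<open>[0, 1]\<close>.
\<close>

definition random_subset :: "'a set \<Rightarrow> real \<Rightarrow> 'a set pmf" where
  "random_subset A p = map_pmf (\<lambda>f. {x \<in> A. f x}) (Pi_pmf A False (\<lambda>_. bernoulli_pmf p))"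

definition intersection_graph :: "nat \<Rightarrow> (nat \<Rightarrow> 'a set) \<Rightarrow> nat set set" where
  "intersection_graph n S =
     {{i, j} | i j. i \<in> {1..n} \<and> j \<in> {1..n} \<and> i \<noteq> j \<and> S i \<inter> S j \<noteq> {}}"

definition RIG :: "nat \<Rightarrow> nat \<Rightarrow> real \<Rightarrow> nat set set pmf" where
  "RIG n d \<delta> =
     map_pmf (intersection_graph n) (Pi_pmf {1..n} {} (\<lambda>_. random_subset {1..d} \<delta>))"

definition erdos_renyi :: "nat \<Rightarrow> real \<Rightarrow> nat set set pmf" where
  "erdos_renyi n p = random_subset (nsets {1..n} 2) p"

definition RGT :: "nat \<Rightarrow> real \<Rightarrow> real \<Rightarrow> nat set set pmf" where
  "RGT n p p' =
     map_pmf (\<lambda>(G, T). G \<union> (\<Union>t\<in>T. nsets t 2))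
       (pair_pmf (erdos_renyi n p) (random_subset (nsets {1..n} 3) p'))"

end

theory Submission
  imports Defs
begin

text \<open>
  A law on the subsets of a finite set \<open>E\<close> is encoded by the function \<open>h A = P (G \<subseteq> A)\<close>. Unions of
  independent random sets then become pointwise products, signed measures are recovered by Moebius
  inversion, and the total variation norm \<open>mnorm\<close> is submultiplicative.

  The intersection graph is the union of \<open>d\<close> independent cliques on random vertex sets. As each of
  them is rarely non-trivial, their number may be taken to be Poisson, so that cliques on different
  vertex sets appear independently; cliques on three vertices then occur exactly as in \<^const>\<open>RGT\<close>. It
  remains to replace the cliques on at least four vertices by independent edges of the same
  intensity. This is done along an interpolation of the intensities: its derivative is the
  difference of the two generators applied to the current law, and since the current law contains
  an independent Erdos-Renyi graph \<open>Q\<close> of constant density, the norm of the derivative is at most that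
  of the difference of generators applied to \<open>Q\<close>. A second moment computation bounds it: two
  cliques contribute only if they share at least three vertices, and the sum over such pairs is of
  order \<open>n ^ 5 / d\<^sup>2\<close>.
\<close>

section \<open>Moebius inversion and the total variation norm\<close>

text \<open>If \<open>h A\<close> is the mass that a signed measure gives to the subsets of
  \<open>A\<close>, this is its mass at the single point \<open>A\<close>.\<close>

definition moebius_inv :: "('a set \<Rightarrow> real) \<Rightarrow> 'a set \<Rightarrow> real" where
  "moebius_inv h A = (\<Sum>B\<in>Pow A. (-1) ^ (card A - card B) * h B)"

text \<open>The total mass of the absolute value of that measure on \<open>Pow E\<close>; for the
  difference of two probability laws it is twice their total variation distance.\<close>

definition mnorm :: "'a set \<Rightarrow> ('a set \<Rightarrow> real) \<Rightarrow> real" where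
  "mnorm E h = (\<Sum>A\<in>Pow E. \<bar>moebius_inv h A\<bar>)"

definition mpos :: "'a set \<Rightarrow> ('a set \<Rightarrow> real) \<Rightarrow> bool" where
  "mpos E h \<longleftrightarrow> (\<forall>A\<in>Pow E. 0 \<le> moebius_inv h A)"

text \<open>Inversion read as uniqueness: to compute a Moebius inverse it is enough to guess
  \<open>f\<close> and to check its sums over subsets.\<close>

lemma moebius_unique:
  assumes "finite A" and eq: "\<And>B. B \<subseteq> A \<Longrightarrow> h B = sum f (Pow B)"
  shows "moebius_inv h A = f A"
proof -
  have "f A = (\<Sum>T\<in>Pow A. (-1) ^ (card A - card T) * sum f (Pow T))"
    by (rule inclusion_exclusion_mobius[OF _ \<open>finite A\<close>]) simp
  then show ?thesis
    unfolding moebius_inv_def using eq by simp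
qed

lemma sum_Pow_moebius:
  assumes "finite A"
  shows "(\<Sum>B\<in>Pow A. moebius_inv h B) = h A"
proof -
  show ?thesis using assms
  proof (induction A rule: finite_psubset_induct)
    case (psubset A)
    \<comment> \<open>\<open>f\<close> is the Moebius inverse below \<open>A\<close>, with the value
      at \<open>A\<close> that makes the sum come out right; by uniqueness that value is the Moebius
      inverse too.\<close>
    define f where "f B = (if B = A then h A - (\<Sum>C\<in>Pow A - {A}. moebius_inv h C) else moebius_inv h B)" for B
    have "moebius_inv h A = f A"
    proof (rule moebius_unique)
      show "finite A" by fact
      fix B assume "B \<subseteq> A"
      show "h B = (\<Sum>C\<in>Pow B. f C)"
      proof (cases "B = A")
        case True
        have "(\<Sum>C\<in>Pow A. f C) = f A + (\<Sum>C\<in>Pow A - {A}. moebius_inv h C)"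
          by (subst sum.remove[of _ A]) (use psubset.hyps in \<open>auto simp: f_def intro!: sum.cong\<close>)
        then show ?thesis using True by (simp add: f_def)
      next
        case False
        then have "(\<Sum>C\<in>Pow B. moebius_inv h C) = h B"
          using \<open>B \<subseteq> A\<close> psubset.IH by blast
        moreover have "(\<Sum>C\<in>Pow B. f C) = (\<Sum>C\<in>Pow B. moebius_inv h C)"
          using False \<open>B \<subseteq> A\<close> by (intro sum.cong) (auto simp: f_def)
        ultimately show ?thesis by simp
      qed
    qed
    then have "moebius_inv h A = h A - (\<Sum>C\<in>Pow A - {A}. moebius_inv h C)"
      by (simp add: f_def)
    then show ?case
      by (subst sum.remove[of _ A]) (use psubset.hyps in auto)
  qed
qed

lemma moebius_cong:
  "(\<And>B. B \<subseteq> A \<Longrightarrow> h B = g B) \<Longrightarrow> moebius_inv h A = moebius_inv g A"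
  unfolding moebius_inv_def by (auto intro!: sum.cong)

lemma mnorm_cong:
  "(\<And>B. B \<subseteq> E \<Longrightarrow> h B = g B) \<Longrightarrow> mnorm E h = mnorm E g"
  unfolding mnorm_def by (auto intro!: sum.cong arg_cong[where f = abs] moebius_cong)

lemma mpos_cong:
  "(\<And>B. B \<subseteq> E \<Longrightarrow> h B = g B) \<Longrightarrow> mpos E h = mpos E g"
  unfolding mpos_def using moebius_cong[of _ h g] by (metis PowD order_trans)

lemma moebius_add: "moebius_inv (\<lambda>B. h B + g B) A = moebius_inv h A + moebius_inv g A"
  by (simp add: moebius_inv_def distrib_left sum.distrib)

lemma moebius_diff: "moebius_inv (\<lambda>B. h B - g B) A = moebius_inv h A - moebius_inv g A"
  by (simp add: moebius_inv_def right_diff_distrib sum_subtractf)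

lemma moebius_cmult: "moebius_inv (\<lambda>B. c * h B) A = c * moebius_inv h A"
  by (simp add: moebius_inv_def sum_distrib_left mult_ac)

lemma moebius_sum: "moebius_inv (\<lambda>B. \<Sum>i\<in>I. h i B) A = (\<Sum>i\<in>I. moebius_inv (h i) A)"
  unfolding moebius_inv_def sum_distrib_left by (rule sum.swap)

lemma moebius_superset:
  assumes "finite A" "C \<subseteq> A"
  shows "moebius_inv (\<lambda>B. of_bool (C \<subseteq> B)) A = of_bool (A = C)"
  by (rule moebius_unique[where f = "\<lambda>B. of_bool (B = C)", OF assms(1)])
     (use assms in \<open>auto simp: sum.delta finite_subset of_bool_def\<close>)

text \<open>\<open>B \<union> C\<close> lies in a set exactly when both \<open>B\<close> and
  \<open>C\<close> do, so pointwise products of transforms correspond to convolution with respect to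
  union.\<close>

lemma moebius_mult:
  assumes "finite A"
  shows "moebius_inv (\<lambda>B. h B * g B) A =
    (\<Sum>(B, C)\<in>{(B, C). B \<subseteq> A \<and> C \<subseteq> A \<and> B \<union> C = A}. moebius_inv h B * moebius_inv g C)"
proof (rule moebius_unique[OF assms])
  fix B assume "B \<subseteq> A"
  then have fB: "finite B" using assms finite_subset by blast
  have "h B * g B = (\<Sum>(C, D)\<in>Pow B \<times> Pow B. moebius_inv h C * moebius_inv g D)"
    unfolding sum.cartesian_product[symmetric] sum_product[symmetric] sum_Pow_moebius[OF fB] by simp
  also have "\<dots> = (\<Sum>X\<in>Pow B. \<Sum>(C, D)\<in>{p. p \<in> Pow B \<times> Pow B \<and> (\<lambda>(C, D). C \<union> D) p = X}. moebius_inv h C * moebius_inv g D)"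
    by (rule sum.group[symmetric]) (use fB in auto)
  also have "\<dots> = (\<Sum>X\<in>Pow B. \<Sum>(C, D)\<in>{(C, D). C \<subseteq> X \<and> D \<subseteq> X \<and> C \<union> D = X}. moebius_inv h C * moebius_inv g D)"
    by (intro sum.cong) auto
  finally show "h B * g B = (\<Sum>X\<in>Pow B. \<Sum>(C, D)\<in>{(C, D). C \<subseteq> X \<and> D \<subseteq> X \<and> C \<union> D = X}. moebius_inv h C * moebius_inv g D)" .
qed

text \<open>Every pair of point masses contributes to exactly one union, so after the triangle
  inequality the sum factorizes.\<close>

lemma mnorm_mult:
  assumes "finite E"
  shows "mnorm E (\<lambda>A. h A * g A) \<le> mnorm E h * mnorm E g"
proof -
  have "mnorm E (\<lambda>A. h A * g A) \<le> (\<Sum>A\<in>Pow E. \<Sum>(B, C)\<in>{p. p \<in> Pow E \<times> Pow E \<and> (\<lambda>(C, D). C \<union> D) p = A}. \<bar>moebius_inv h B\<bar> * \<bar>moebius_inv g C\<bar>)"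
    unfolding mnorm_def
  proof (rule sum_mono)
    fix A assume A: "A \<in> Pow E"
    then have fA: "finite A" using assms finite_subset by auto
    have "{(B, C). B \<subseteq> A \<and> C \<subseteq> A \<and> B \<union> C = A} = {p. p \<in> Pow E \<times> Pow E \<and> (\<lambda>(C, D). C \<union> D) p = A}"
      using A by auto
    then show "\<bar>moebius_inv (\<lambda>A. h A * g A) A\<bar> \<le> (\<Sum>(B, C)\<in>{p. p \<in> Pow E \<times> Pow E \<and> (\<lambda>(C, D). C \<union> D) p = A}. \<bar>moebius_inv h B\<bar> * \<bar>moebius_inv g C\<bar>)"
      unfolding moebius_mult[OF fA]
      by (simp only:) (rule order_trans[OF sum_abs], auto simp: abs_mult split_def)
  qed
  also have "\<dots> = (\<Sum>(B, C)\<in>Pow E \<times> Pow E. \<bar>moebius_inv h B\<bar> * \<bar>moebius_inv g C\<bar>)"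
    by (rule sum.group) (use assms in auto)
  also have "\<dots> = mnorm E h * mnorm E g"
    by (simp add: mnorm_def sum_product sum.cartesian_product)
  finally show ?thesis .
qed

lemma mnorm_add: "mnorm E (\<lambda>A. h A + g A) \<le> mnorm E h + mnorm E g"
  unfolding mnorm_def moebius_add sum.distrib[symmetric] by (intro sum_mono) auto

lemma mnorm_diff: "mnorm E (\<lambda>A. h A - g A) \<le> mnorm E h + mnorm E g"
  unfolding mnorm_def moebius_diff sum.distrib[symmetric] by (intro sum_mono) auto

lemma mnorm_cmult: "mnorm E (\<lambda>A. c * h A) = \<bar>c\<bar> * mnorm E h"
  unfolding mnorm_def moebius_cmult by (simp add: abs_mult sum_distrib_left)

lemma mnorm_sum: "mnorm E (\<lambda>A. \<Sum>i\<in>I. h i A) \<le> (\<Sum>i\<in>I. mnorm E (h i))"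
proof -
  have "mnorm E (\<lambda>A. \<Sum>i\<in>I. h i A) \<le> (\<Sum>A\<in>Pow E. \<Sum>i\<in>I. \<bar>moebius_inv (h i) A\<bar>)"
    unfolding mnorm_def moebius_sum by (intro sum_mono sum_abs)
  also have "\<dots> = (\<Sum>i\<in>I. mnorm E (h i))"
    unfolding mnorm_def by (rule sum.swap)
  finally show ?thesis .
qed

lemma mnorm_nonneg: "0 \<le> mnorm E h"
  by (simp add: mnorm_def sum_nonneg)

section \<open>Transforms of non-negative measures\<close>

lemma mnorm_mpos:
  assumes "finite E" "mpos E h"
  shows "mnorm E h = h E"
proof -
  have "mnorm E h = (\<Sum>A\<in>Pow E. moebius_inv h A)"
    unfolding mnorm_def using assms(2) by (intro sum.cong) (auto simp: mpos_def)
  then show ?thesis using sum_Pow_moebius[OF assms(1)] by simp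
qed

lemma mpos_add: "mpos E h \<Longrightarrow> mpos E g \<Longrightarrow> mpos E (\<lambda>A. h A + g A)"
  by (auto simp: mpos_def moebius_add)

lemma mpos_cmult: "mpos E h \<Longrightarrow> 0 \<le> c \<Longrightarrow> mpos E (\<lambda>A. c * h A)"
  by (auto simp: mpos_def moebius_cmult)

lemma mpos_sum: "(\<And>i. i \<in> I \<Longrightarrow> mpos E (h i)) \<Longrightarrow> mpos E (\<lambda>A. \<Sum>i\<in>I. h i A)"
  by (auto simp: mpos_def moebius_sum intro!: sum_nonneg)

lemma mpos_mult:
  assumes "finite E" "mpos E h" "mpos E g"
  shows "mpos E (\<lambda>A. h A * g A)"
  unfolding mpos_def
proof
  fix A assume A: "A \<in> Pow E"
  then have "finite A" using assms finite_subset by auto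
  from moebius_mult[OF this] show "0 \<le> moebius_inv (\<lambda>A. h A * g A) A"
    using A assms(2,3) by (auto simp: mpos_def intro!: sum_nonneg)
qed

lemma mpos_superset:
  assumes "finite E"
  shows "mpos E (\<lambda>A. of_bool (C \<subseteq> A))"
  unfolding mpos_def
proof
  fix A assume A: "A \<in> Pow E"
  then have fA: "finite A" using assms finite_subset by auto
  show "0 \<le> moebius_inv (\<lambda>A. of_bool (C \<subseteq> A)) A"
  proof (cases "C \<subseteq> A")
    case True
    then show ?thesis using moebius_superset[OF fA] by auto
  next
    case False
    then have "moebius_inv (\<lambda>A. of_bool (C \<subseteq> A)) A = moebius_inv (\<lambda>A. 0) A"
      by (intro moebius_cong) auto
    then show ?thesis by (simp add: moebius_inv_def)
  qed
qed

lemma mpos_one: "finite E \<Longrightarrow> mpos E (\<lambda>A. 1)"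
  using mpos_superset[of E "{}"] by simp

lemma mnorm_superset_le:
  assumes "finite E" shows "mnorm E (\<lambda>A. of_bool (C \<subseteq> A)) \<le> 1"
  using mnorm_mpos[OF assms mpos_superset[OF assms]] by simp

lemma mpos_power:
  assumes "finite E" "mpos E h"
  shows "mpos E (\<lambda>A. h A ^ k)"
  by (induction k) (use assms mpos_one mpos_mult in auto)

text \<open>A Moebius inverse is a finite linear combination of values, so non-negativity passes to
  pointwise limits.\<close>

lemma mpos_limit:
  assumes "\<And>k. mpos E (h k)" and "\<And>A. A \<subseteq> E \<Longrightarrow> (\<lambda>k. h k A) \<longlonglongrightarrow> g A"
  shows "mpos E g"
  unfolding mpos_def
proof
  fix A assume A: "A \<in> Pow E"
  have "(\<lambda>k. moebius_inv (h k) A) \<longlonglongrightarrow> moebius_inv g A"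
    unfolding moebius_inv_def using A by (intro tendsto_sum tendsto_mult tendsto_const assms(2)) auto
  then show "0 \<le> moebius_inv g A"
    by (rule LIMSEQ_le_const) (use assms(1) A in \<open>auto simp: mpos_def\<close>)
qed

text \<open>The transform of a compound Poisson law for the union operation.\<close>

lemma mpos_exp_superset:
  assumes "finite E" "finite I" "\<And>i. i \<in> I \<Longrightarrow> 0 \<le> c i"
  shows "mpos E (\<lambda>A. exp (- (\<Sum>i\<in>I. c i * of_bool (\<not> C i \<subseteq> A))))"
  using assms(2,3)
proof (induction I rule: finite_induct)
  case empty
  then show ?case using mpos_one[OF assms(1)] by simp
next
  case (insert i I)
  \<comment> \<open>This is the transform of a random set that equals \<open>C i\<close> with
    probability \<open>1 - exp (- c i)\<close> and is empty otherwise.\<close>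
  have "mpos E (\<lambda>A. exp (- c i) * 1 + (1 - exp (- c i)) * of_bool (C i \<subseteq> A))"
    using insert.prems by (intro mpos_add mpos_cmult mpos_one mpos_superset assms(1)) auto
  then have "mpos E (\<lambda>A. (exp (- c i) * 1 + (1 - exp (- c i)) * of_bool (C i \<subseteq> A)) * exp (- (\<Sum>i\<in>I. c i * of_bool (\<not> C i \<subseteq> A))))"
    using insert by (intro mpos_mult assms(1)) auto
  also have "?this \<longleftrightarrow> ?case"
    using insert.hyps by (intro mpos_cong) (auto simp: exp_add exp_diff exp_minus field_simps)
  finally show ?case .
qed

section \<open>Poissonization\<close>

text \<open>The quotient of consecutive terms is \<open>exp 1 * (m / (m + 1)) ^ (m + 1)\<close>,
  which is at most \<open>1\<close> because \<open>1 + x \<le> exp x\<close> at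
  \<open>x = - 1 / (m + 1)\<close>. This takes the place of Stirling's formula.\<close>

lemma fact_exp_ratio_decreasing:
  assumes "1 \<le> j" "j \<le> d"
  shows "fact d * exp (real d) / real d ^ (d + 1) \<le> fact j * exp (real j) / real j ^ (j + 1)"
  using assms(2)
proof (induction d rule: dec_induct)
  case base
  show ?case by simp
next
  case (step m)
  have m: "m \<ge> 1" using step assms by simp
  have "real m / real (m + 1) = 1 + (- 1 / real (m + 1))"
    by (simp add: field_simps)
  also have "\<dots> \<le> exp (- 1 / real (m + 1))"
    by (rule exp_ge_add_one_self)
  finally have "(real m / real (m + 1)) ^ (m + 1) \<le> exp (- 1 / real (m + 1)) ^ (m + 1)"
    by (intro power_mono) auto
  also have "\<dots> = exp (- 1)"
    by (subst exp_of_nat_mult[symmetric]) (simp add: field_simps)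
  finally have "exp 1 * (real m / real (m + 1)) ^ (m + 1) \<le> 1"
    by (simp add: exp_minus field_simps)
  then have "(fact m * exp (real m) / real m ^ (m + 1)) * (exp 1 * (real m / real (m + 1)) ^ (m + 1)) \<le> fact m * exp (real m) / real m ^ (m + 1)"
    by (intro mult_left_le) auto
  moreover have "(fact m * exp (real m) / real m ^ (m + 1)) * (exp 1 * (real m / real (m + 1)) ^ (m + 1)) = fact (Suc m) * exp (real (Suc m)) / real (Suc m) ^ (Suc m + 1)"
    using m by (simp add: exp_add power_divide divide_simps)
  ultimately show ?case using step.IH by linarith
qed

text \<open>The ratio of the binomial and Poisson weights at \<open>k\<close> is largest when \<open>q = k / d\<close>.\<close>

lemma binomial_le_poisson:
  fixes q :: real
  assumes "0 \<le> q" "q \<le> 1" "k < d"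
  shows "real (d choose k) * (1 - q) ^ (d - k) * exp (real d * q) * fact k * real (d - k) \<le> real d ^ (k + 1)"
proof -
  define j where "j = d - k"
  have j: "1 \<le> j" "j \<le> d" "d = k + j" using assms by (auto simp: j_def)
  \<comment> \<open>\<open>1 + x \<le> exp x\<close> with \<open>x = (1 - q) * d / j - 1\<close>,
    which vanishes at \<open>q = k / d\<close>; this removes \<open>q\<close> from the
    estimate.\<close>
  have "((1 - q) * real d / real j) ^ j \<le> exp ((1 - q) * real d / real j - 1) ^ j"
    using exp_ge_add_one_self[of "(1 - q) * real d / real j - 1"] assms by (intro power_mono) auto
  also have "\<dots> = exp ((1 - q) * real d - real j)"
    using j by (subst exp_of_nat_mult[symmetric]) (simp add: field_simps)
  finally have "(1 - q) ^ j * real d ^ j \<le> real j ^ j * exp ((1 - q) * real d - real j)"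
    using j(1) by (simp add: power_divide power_mult_distrib pos_divide_le_eq mult_ac)
  then have "(1 - q) ^ j * real d ^ j * exp (real d * q) \<le> real j ^ j * exp ((1 - q) * real d - real j) * exp (real d * q)"
    by (rule mult_right_mono) simp
  also have "\<dots> = real j ^ j * exp (real k)"
    using j by (simp add: mult.assoc flip: exp_add) (simp add: algebra_simps)
  finally have a: "(1 - q) ^ j * exp (real d * q) * real d ^ j \<le> real j ^ j * exp (real k)"
    by (simp add: mult_ac)
  have b: "fact d * exp (real k) * real j ^ (j + 1) \<le> fact j * real d ^ (d + 1)"
  proof -
    have "exp (real d) = exp (real k) * exp (real j)"
      using j by (simp flip: exp_add)
    then have "fact d * (exp (real k) * exp (real j)) * real j ^ (j + 1) \<le> fact j * exp (real j) * real d ^ (d + 1)"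
      using fact_exp_ratio_decreasing[OF j(1,2)] j(1,2) by (simp add: divide_simps mult_ac)
    then have "(fact d * exp (real k) * real j ^ (j + 1)) * exp (real j) \<le> (fact j * real d ^ (d + 1)) * exp (real j)"
      by (simp add: mult_ac)
    then show ?thesis by (rule mult_right_le_imp_le) simp
  qed
  have c: "real (d choose k) * fact k * fact j = fact d"
    using binomial_fact[of k d, where ?'a = real] assms by (simp add: j_def)
  have "real (d choose k) * (1 - q) ^ j * exp (real d * q) * fact k * real j * (fact j * real d ^ j)
     = (real (d choose k) * fact k * fact j) * real j * ((1 - q) ^ j * exp (real d * q) * real d ^ j)"
    by (simp add: mult_ac)
  also have "\<dots> \<le> fact d * real j * (real j ^ j * exp (real k))"
    unfolding c by (intro mult_left_mono a) auto
  also have "\<dots> = fact d * exp (real k) * real j ^ (j + 1)"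
    by (simp add: mult_ac)
  also have "\<dots> \<le> fact j * real d ^ (d + 1)" by (rule b)
  also have "\<dots> = real d ^ (k + 1) * (fact j * real d ^ j)"
    using j(3) by (simp add: power_add)
  finally show ?thesis
    unfolding j_def[symmetric] using j by simp
qed

text \<open>The difference is the tail of the exponential series, a limit of sums of powers of
  \<open>r\<close> with non-negative coefficients.\<close>

lemma mpos_exp_minus_partial_sum:
  assumes "finite E" "mpos E r"
  shows "mpos E (\<lambda>A. exp (r A) - (\<Sum>k\<le>K. r A ^ k / fact k))"
proof (rule mpos_limit[where h = "\<lambda>i A. \<Sum>k\<in>{Suc K..<Suc K + i}. r A ^ k / fact k"])
  fix i
  have "mpos E (\<lambda>A. \<Sum>k\<in>{Suc K..<Suc K + i}. (1 / fact k) * r A ^ k)"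
    by (intro mpos_sum mpos_cmult mpos_power assms) auto
  then show "mpos E (\<lambda>A. \<Sum>k\<in>{Suc K..<Suc K + i}. r A ^ k / fact k)"
    by simp
next
  fix A
  have "(\<lambda>k. r A ^ k / fact k) sums exp (r A)"
    using exp_converges[of "r A"] by (simp add: divide_inverse mult.commute)
  then have "(\<lambda>N. \<Sum>k<N. r A ^ k / fact k) \<longlonglongrightarrow> exp (r A)"
    by (simp only: sums_def)
  from LIMSEQ_ignore_initial_segment[OF this, of "Suc K"]
  have "(\<lambda>i. \<Sum>k<i + Suc K. r A ^ k / fact k) \<longlonglongrightarrow> exp (r A)" .
  then have "(\<lambda>i. (\<Sum>k<i + Suc K. r A ^ k / fact k) - (\<Sum>k\<le>K. r A ^ k / fact k)) \<longlonglongrightarrow> exp (r A) - (\<Sum>k\<le>K. r A ^ k / fact k)"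
    by (rule tendsto_diff[OF _ tendsto_const])
  moreover have "(\<Sum>k<i + Suc K. r A ^ k / fact k) - (\<Sum>k\<le>K. r A ^ k / fact k) = (\<Sum>k\<in>{Suc K..<Suc K + i}. r A ^ k / fact k)" for i
  proof -
    have "(\<Sum>k\<in>{..K} \<union> {Suc K..<Suc K + i}. r A ^ k / fact k) = (\<Sum>k\<le>K. r A ^ k / fact k) + (\<Sum>k\<in>{Suc K..<Suc K + i}. r A ^ k / fact k)"
      by (intro sum.union_disjoint) auto
    moreover have "{..K} \<union> {Suc K..<Suc K + i} = {..<i + Suc K}" by auto
    ultimately have "(\<Sum>k<i + Suc K. r A ^ k / fact k) = (\<Sum>k\<le>K. r A ^ k / fact k) + (\<Sum>k\<in>{Suc K..<Suc K + i}. r A ^ k / fact k)"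
      by (simp only:)
    then show ?thesis by linarith
  qed
  ultimately show "(\<lambda>i. \<Sum>k\<in>{Suc K..<Suc K + i}. r A ^ k / fact k) \<longlonglongrightarrow> exp (r A) - (\<Sum>k\<le>K. r A ^ k / fact k)"
    by (simp only:)
qed

text \<open>Markov's inequality: the Bernstein polynomials are the binomial weights, whose mean is
  \<open>d * q\<close>.\<close>

lemma binomial_tail_le:
  fixes q \<epsilon> :: real
  assumes "0 \<le> q" "q \<le> 1" "0 < \<epsilon>" "0 < d"
  shows "(\<Sum>k | k \<le> d \<and> \<epsilon> * real d < real k. Bernstein d k q) \<le> q / \<epsilon>"
proof -
  have "(\<Sum>k | k \<le> d \<and> \<epsilon> * real d < real k. Bernstein d k q) \<le> (\<Sum>k | k \<le> d \<and> \<epsilon> * real d < real k. real k * Bernstein d k q / (\<epsilon> * real d))"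
  proof (rule sum_mono)
    fix k assume "k \<in> {k. k \<le> d \<and> \<epsilon> * real d < real k}"
    then have "\<epsilon> * real d \<le> real k" by simp
    from mult_right_mono[OF this Bernstein_nonneg[OF assms(1,2)]]
    show "Bernstein d k q \<le> real k * Bernstein d k q / (\<epsilon> * real d)"
      using assms by (simp add: field_simps)
  qed
  also have "\<dots> \<le> (\<Sum>k\<le>d. real k * Bernstein d k q / (\<epsilon> * real d))"
    using assms by (intro sum_mono2) (auto intro!: mult_nonneg_nonneg divide_nonneg_nonneg Bernstein_nonneg)
  also have "\<dots> = q / \<epsilon>"
    using assms by (simp flip: sum_divide_distrib)
  finally show ?thesis .
qed

text \<open>Both transforms are power series in \<open>r\<close>, mixtures over a binomial and over
  a Poisson number of draws. Up to \<open>\<epsilon> * d\<close> draws the binomial weights are at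
  most \<open>1 / (1 - \<epsilon>)\<close> times the Poisson ones, and more draws have small
  probability by Markov's inequality. The bound depends on \<open>q\<close> but not on the mean
  \<open>d * q\<close>, which may be large.\<close>

lemma mnorm_poissonization:
  fixes \<epsilon> q :: real
  assumes E: "finite E" and r: "mpos E r" "r E = q" and q: "q \<le> 1" and \<epsilon>: "0 < \<epsilon>" "\<epsilon> < 1" and d: "0 < d"
  shows "mnorm E (\<lambda>A. (1 - q + r A) ^ d - exp (real d * (r A - q))) \<le> 2 * \<epsilon> + 2 * (q / \<epsilon>)"
proof -
  have q0: "0 \<le> q"
    using mnorm_mpos[OF E r(1)] mnorm_nonneg[of E r] r(2) by simp
  define b where "b k = real (d choose k) * (1 - q) ^ (d - k)" for k
  define p where "p k = exp (- (real d * q)) * real d ^ k / fact k" for k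
  define K where "K = nat \<lfloor>\<epsilon> * real d\<rfloor>"
  have K: "k \<le> K \<longleftrightarrow> real k \<le> \<epsilon> * real d" for k
    unfolding K_def using \<epsilon> by (simp add: le_nat_iff le_floor_iff)
  have Kd: "K < d"
  proof -
    have "real K \<le> \<epsilon> * real d" using K by blast
    also have "\<dots> < real d" using \<epsilon> d by simp
    finally show ?thesis by simp
  qed
  define f where "f A = (1 - q + r A) ^ d" for A
  define g where "g A = exp (real d * (r A - q))" for A
  \<comment> \<open>\<open>R\<close> is the part of \<open>(1 - \<epsilon>) * f\<close> with more
    than \<open>K\<close> draws, \<open>D1\<close> the part of \<open>g\<close> with more than
    \<open>K\<close> draws, and \<open>D2\<close> the surplus of \<open>g\<close> over
    \<open>(1 - \<epsilon>) * f\<close> up to \<open>K\<close> draws. All three come from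
    non-negative measures.\<close>
  define R where "R A = (1 - \<epsilon>) * (\<Sum>k\<in>{Suc K..d}. b k * r A ^ k)" for A
  define D1 where "D1 A = exp (- (real d * q)) * (exp (real d * r A) - (\<Sum>k\<le>K. (real d * r A) ^ k / fact k))" for A
  define D2 where "D2 A = (\<Sum>k\<le>K. (p k - (1 - \<epsilon>) * b k) * r A ^ k)" for A
  have b0: "0 \<le> b k" for k using q by (simp add: b_def)
  have f: "f A = (\<Sum>k\<le>d. b k * r A ^ k)" for A
    unfolding f_def b_def add.commute[of "1 - q"] binomial_ring by (intro sum.cong) (auto simp: mult_ac)
  have fpos: "mpos E f"
    unfolding f by (intro mpos_sum mpos_cmult mpos_power E r b0)
  have Rpos: "mpos E R"
    unfolding R_def using \<epsilon> by (intro mpos_sum mpos_cmult mpos_power E r b0) auto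
  have D1: "mpos E D1"
    unfolding D1_def by (intro mpos_cmult mpos_exp_minus_partial_sum E r) auto
  \<comment> \<open>\<open>binomial_le_poisson\<close> compares the weights with the factor
    \<open>d / (d - k)\<close>, which is at most \<open>1 / (1 - \<epsilon>)\<close> for these
    \<open>k\<close>.\<close>
  have bp: "(1 - \<epsilon>) * b k \<le> p k" if "k \<le> K" for k
  proof -
    have kd: "k < d" "real k \<le> \<epsilon> * real d" using that Kd K[of k] by linarith+
    have "(1 - \<epsilon>) * real d \<le> real (d - k)"
      using kd by (simp add: algebra_simps of_nat_diff)
    then have "b k * exp (real d * q) * fact k * ((1 - \<epsilon>) * real d) \<le> b k * exp (real d * q) * fact k * real (d - k)"
      by (intro mult_left_mono) (auto simp: b0)
    also have "\<dots> \<le> real d ^ k * real d"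
      using binomial_le_poisson[OF q0 q kd(1)] by (simp add: b_def mult_ac)
    finally have "((1 - \<epsilon>) * b k * exp (real d * q) * fact k) * real d \<le> real d ^ k * real d"
      by (simp add: mult_ac)
    then have "(1 - \<epsilon>) * b k * exp (real d * q) * fact k \<le> real d ^ k"
      using d by simp
    then show ?thesis by (simp add: p_def exp_minus field_simps)
  qed
  have D2: "mpos E D2"
    unfolding D2_def using bp by (intro mpos_sum mpos_cmult mpos_power E r) auto
  have P: "mpos E (\<lambda>A. D1 A + D2 A)" by (intro mpos_add D1 D2)
  have split: "f A = (\<Sum>k\<le>K. b k * r A ^ k) + (\<Sum>k\<in>{Suc K..d}. b k * r A ^ k)" for A
  proof -
    have "{..d} = {..K} \<union> {Suc K..d}" using Kd by auto
    then show ?thesis unfolding f by (simp only:) (rule sum.union_disjoint, auto)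
  qed
  have eq: "D1 A + D2 A = g A - (1 - \<epsilon>) * f A + R A" for A
  proof -
    have "D1 A = g A - (\<Sum>k\<le>K. p k * r A ^ k)"
    proof -
      have "g A = exp (- (real d * q)) * exp (real d * r A)"
        by (simp add: g_def algebra_simps flip: exp_add)
      moreover have "(\<Sum>k\<le>K. p k * r A ^ k) = exp (- (real d * q)) * (\<Sum>k\<le>K. (real d * r A) ^ k / fact k)"
        unfolding sum_distrib_left by (intro sum.cong) (auto simp: p_def power_mult_distrib)
      ultimately show ?thesis by (simp only: D1_def right_diff_distrib)
    qed
    moreover have "D2 A = (\<Sum>k\<le>K. p k * r A ^ k) - (1 - \<epsilon>) * (\<Sum>k\<le>K. b k * r A ^ k)"
      unfolding D2_def sum_distrib_left sum_subtractf[symmetric] by (intro sum.cong) (auto simp: algebra_simps)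
    moreover have "(1 - \<epsilon>) * f A = (1 - \<epsilon>) * (\<Sum>k\<le>K. b k * r A ^ k) + R A"
      by (simp only: split R_def distrib_left)
    ultimately show ?thesis by linarith
  qed
  have fE: "f E = 1" "g E = 1" by (simp_all add: f_def g_def r)
  have RE: "R E \<le> q / \<epsilon>"
  proof -
    have "k \<in> {Suc K..d} \<longleftrightarrow> k \<in> {k. k \<le> d \<and> \<epsilon> * real d < real k}" for k
      unfolding atLeastAtMost_iff mem_Collect_eq Suc_le_eq linorder_not_le[of k K, symmetric] K
      by (simp only: linorder_not_le conj_commute)
    then have "{Suc K..d} = {k. k \<le> d \<and> \<epsilon> * real d < real k}"
      by (rule set_eqI)
    then have "(\<Sum>k\<in>{Suc K..d}. b k * q ^ k) \<le> q / \<epsilon>"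
      using binomial_tail_le[OF q0 q \<epsilon>(1) d] by (simp add: b_def Bernstein_def mult_ac)
    moreover have "0 \<le> (\<Sum>k\<in>{Suc K..d}. b k * q ^ k)"
      using b0 q0 by (intro sum_nonneg) auto
    ultimately show ?thesis
      unfolding R_def r(2)
      using \<epsilon> mult_left_le_one_le[of "\<Sum>k\<in>{Suc K..d}. b k * q ^ k" "1 - \<epsilon>"] by linarith
  qed
  \<comment> \<open>The norm of a difference of two non-negative measures is at most the sum of
    their total masses, which are the values at \<open>E\<close>.\<close>
  have "mnorm E (\<lambda>A. f A - g A) = mnorm E (\<lambda>A. (\<epsilon> * f A + R A) - (D1 A + D2 A))"
    unfolding eq by (rule mnorm_cong) (simp add: left_diff_distrib)
  also have "\<dots> \<le> mnorm E (\<lambda>A. \<epsilon> * f A + R A) + mnorm E (\<lambda>A. D1 A + D2 A)"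
    by (rule mnorm_diff)
  also have "mnorm E (\<lambda>A. \<epsilon> * f A + R A) = \<epsilon> * f E + R E"
    using \<epsilon> by (intro mnorm_mpos E mpos_add mpos_cmult fpos Rpos) auto
  also have "mnorm E (\<lambda>A. D1 A + D2 A) = g E - (1 - \<epsilon>) * f E + R E"
    unfolding eq[symmetric] by (intro mnorm_mpos E P)
  also have "(\<epsilon> * f E + R E) + (g E - (1 - \<epsilon>) * f E + R E) \<le> 2 * \<epsilon> + 2 * (q / \<epsilon>)"
    using RE fE by simp
  finally show ?thesis unfolding f_def g_def .
qed

section \<open>Replacing blocks by independent elements\<close>

text \<open>With \<open>B = C \<union> D\<close> and \<open>D \<subseteq> A - C\<close> this is the
  binomial theorem over \<open>D\<close>. For \<open>a + b = 1\<close> it gives the probability that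
  a random subset of \<open>E\<close> lies between \<open>C\<close> and \<open>A\<close>.\<close>

lemma sum_between_power:
  fixes a b :: "'b::comm_semiring_1"
  assumes "finite E" "C \<subseteq> A" "A \<subseteq> E"
  shows "(\<Sum>B | C \<subseteq> B \<and> B \<subseteq> A. a ^ card B * b ^ card (E - B)) =
    a ^ card C * b ^ card (E - A) * (a + b) ^ card (A - C)"
proof -
  have fin: "finite A" "finite C" using assms by (auto intro: finite_subset)
  have "(\<Sum>B | C \<subseteq> B \<and> B \<subseteq> A. a ^ card B * b ^ card (E - B)) =
    (\<Sum>D\<in>Pow (A - C). a ^ card (C \<union> D) * b ^ card (E - (C \<union> D)))"
    by (rule sum.reindex_bij_witness[of _ "\<lambda>D. C \<union> D" "\<lambda>B. B - C"])
       (use assms in \<open>auto simp: Un_absorb1\<close>)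
  also have "\<dots> = (\<Sum>D\<in>Pow (A - C). (a ^ card C * b ^ card (E - A)) * (a ^ card D * b ^ card (A - C - D)))"
  proof (rule sum.cong[OF refl])
    fix D assume D: "D \<in> Pow (A - C)"
    then have "finite D" using fin by (auto intro: finite_subset)
    then have 1: "card (C \<union> D) = card C + card D"
      using D fin by (intro card_Un_disjoint) auto
    have "E - (C \<union> D) = (E - A) \<union> (A - C - D)" using D assms by auto
    then have 2: "card (E - (C \<union> D)) = card (E - A) + card (A - C - D)"
      using assms fin by (simp only:) (intro card_Un_disjoint, auto)
    show "a ^ card (C \<union> D) * b ^ card (E - (C \<union> D)) = (a ^ card C * b ^ card (E - A)) * (a ^ card D * b ^ card (A - C - D))"
      unfolding 1 2 power_add by (simp add: mult_ac)
  qed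
  also have "\<dots> = a ^ card C * b ^ card (E - A) * (\<Sum>D\<in>Pow (A - C). a ^ card D * b ^ card (A - C - D))"
    by (simp add: sum_distrib_left)
  also have "(\<Sum>D\<in>Pow (A - C). a ^ card D * b ^ card (A - C - D)) = (a + b) ^ card (A - C)"
    using prod_add[of "A - C" "\<lambda>_. a" "\<lambda>_. b"] fin by simp
  finally show ?thesis .
qed

text \<open>The logarithmic rate of inserting a block \<open>C\<close> as a whole, minus the rates of inserting its elements
  one by one.\<close>

definition excess :: "'a set \<Rightarrow> 'a set \<Rightarrow> real" where
  "excess C A = real (card (C - A)) - of_bool (\<not> C \<subseteq> A)"

text \<open>In this form every term is an indicator of supersets minus a constant, so its Moebius
  inverse is explicit.\<close>

lemma excess_altdef:
  assumes "finite C"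
  shows "excess C A = of_bool (C \<subseteq> A) - 1 - (\<Sum>e\<in>C. of_bool ({e} \<subseteq> A) - 1)"
proof -
  have "(\<Sum>e\<in>C. of_bool ({e} \<subseteq> A) - 1 :: real) = (\<Sum>e\<in>C. if e \<in> A then 0 else - 1)"
    by (intro sum.cong) auto
  also have "\<dots> = (\<Sum>e\<in>C - A. - 1)"
    using assms by (intro sum.mono_neutral_cong_right) auto
  also have "\<dots> = - real (card (C - A))"
    by simp
  finally show ?thesis by (simp add: excess_def)
qed

section \<open>Second moments under a Bernoulli product measure\<close>

locale bernoulli_weights =
  fixes E :: "'a set" and p :: real
  assumes E: "finite E" and p: "0 < p" "p \<le> 1"
begin

definition W :: "'a set \<Rightarrow> real" where
  "W B = p ^ card B * (1 - p) ^ card (E - B)"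

text \<open>The union of a Bernoulli set with \<open>C\<close> has the density
  \<open>of_bool (C \<subseteq> B) / p ^ card C\<close> with respect to \<open>W\<close>;
  \<open>eta\<close> is this density minus one.\<close>

definition eta :: "'a set \<Rightarrow> 'a set \<Rightarrow> real" where
  "eta C B = of_bool (C \<subseteq> B) / p ^ card C - 1"

text \<open>That density is the product of \<open>1 + eta {e} B\<close> over
  \<open>e \<in> C\<close>; \<open>chi\<close> keeps the terms of degree at least two of the
  expanded product.\<close>

definition chi :: "'a set \<Rightarrow> 'a set \<Rightarrow> real" where
  "chi C B = eta C B - (\<Sum>e\<in>C. eta {e} B)"

lemma W_nonneg: "0 \<le> W B"
  using p by (simp add: W_def)

lemma sum_W_superset:
  assumes "C \<subseteq> A" "A \<subseteq> E"
  shows "(\<Sum>B\<in>Pow A. W B * of_bool (C \<subseteq> B)) = p ^ card C * (1 - p) ^ card (E - A)"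
proof -
  have "finite A" using assms E finite_subset by auto
  then have "(\<Sum>B\<in>Pow A. W B * of_bool (C \<subseteq> B)) = (\<Sum>B | C \<subseteq> B \<and> B \<subseteq> A. W B)"
    by (intro sum.mono_neutral_cong_right) auto
  then show ?thesis
    using sum_between_power[OF E assms, of p "1 - p"] by (simp add: W_def)
qed

lemma moebius_smooth_superset:
  assumes "B \<subseteq> E" "C \<subseteq> E"
  shows "moebius_inv (\<lambda>A. (1 - p) ^ card (E - A) * of_bool (C \<subseteq> A)) B = W B * (of_bool (C \<subseteq> B) / p ^ card C)"
proof (rule moebius_unique)
  show "finite B" using assms E finite_subset by auto
  fix A assume A: "A \<subseteq> B"
  show "(1 - p) ^ card (E - A) * of_bool (C \<subseteq> A) = (\<Sum>D\<in>Pow A. W D * (of_bool (C \<subseteq> D) / p ^ card C))"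
  proof (cases "C \<subseteq> A")
    case True
    have "(\<Sum>D\<in>Pow A. W D * (of_bool (C \<subseteq> D) / p ^ card C)) = (\<Sum>D\<in>Pow A. W D * of_bool (C \<subseteq> D)) / p ^ card C"
      by (simp add: sum_divide_distrib)
    then show ?thesis
      using True sum_W_superset[of C A] A assms p by simp
  next
    case False
    then have "\<not> C \<subseteq> D" if "D \<subseteq> A" for D using that by auto
    then show ?thesis using False by simp
  qed
qed

text \<open>The product of the indicators for \<open>C\<close> and \<open>D\<close> is the one for
  \<open>C \<union> D\<close>, with expectation \<open>p ^ card (C \<union> D)\<close>; dividing by
  \<open>p ^ card C * p ^ card D\<close> leaves the exponent \<open>card (C \<inter> D)\<close> of
  \<open>1 / p\<close>.\<close>

lemma sum_W_eta_eta:
  assumes "C \<subseteq> E" "D \<subseteq> E"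
  shows "(\<Sum>B\<in>Pow E. W B * (eta C B * eta D B)) = (1 / p) ^ card (C \<inter> D) - 1"
proof -
  have fin: "finite C" "finite D" using assms E finite_subset by auto
  have one: "(\<Sum>B\<in>Pow E. W B * of_bool (X \<subseteq> B)) = p ^ card X" if "X \<subseteq> E" for X
    using sum_W_superset[OF that order_refl] by simp
  have W1: "sum W (Pow E) = 1"
    using one[of "{}"] by simp
  have "(\<Sum>B\<in>Pow E. W B * (eta C B * eta D B)) =
    (\<Sum>B\<in>Pow E. W B * of_bool (C \<union> D \<subseteq> B) / (p ^ card C * p ^ card D) - W B * of_bool (C \<subseteq> B) / p ^ card C
      - W B * of_bool (D \<subseteq> B) / p ^ card D + W B * of_bool ({} \<subseteq> B))"
    by (intro sum.cong refl) (auto simp: eta_def algebra_simps)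
  also have "\<dots> = p ^ card (C \<union> D) / (p ^ card C * p ^ card D) - 1"
    unfolding sum.distrib sum_subtractf sum_divide_distrib[symmetric]
    using p assms W1 by (simp only: one Un_least) simp
  also have "p ^ card (C \<union> D) / (p ^ card C * p ^ card D) = (1 / p) ^ card (C \<inter> D)"
    using p card_Un_Int[OF fin] by (simp add: power_divide divide_simps flip: power_add)
  finally show ?thesis .
qed

text \<open>In the bilinear expansion each of the three sums that involve singletons equals
  \<open>card (C \<inter> D) * (1 / p - 1)\<close>; two enter with a minus sign and one with a plus
  sign. The result vanishes when \<open>C\<close> and \<open>D\<close> share at most one
  element.\<close>

lemma sum_W_chi_chi:
  assumes "C \<subseteq> E" "D \<subseteq> E"
  shows "(\<Sum>B\<in>Pow E. W B * (chi C B * chi D B)) =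
    (1 / p) ^ card (C \<inter> D) - 1 - real (card (C \<inter> D)) * (1 / p - 1)"
proof -
  have fin: "finite C" "finite D" using assms E finite_subset by auto
  have single: "(\<Sum>e\<in>X. (1 / p) ^ card ({e} \<inter> Y) - 1) = real (card (X \<inter> Y)) * (1 / p - 1)"
    if "finite X" for X Y :: "'a set"
  proof -
    have "(\<Sum>e\<in>X. (1 / p) ^ card ({e} \<inter> Y) - 1) = (\<Sum>e\<in>X. if e \<in> Y then 1 / p - 1 else 0)"
      by (intro sum.cong) auto
    also have "\<dots> = (\<Sum>e\<in>X \<inter> Y. 1 / p - 1)"
      using that by (rule sum.inter_restrict[symmetric])
    finally show ?thesis by simp
  qed
  have *: "(\<Sum>B\<in>Pow E. W B * (chi C B * chi D B)) =
     (\<Sum>B\<in>Pow E. W B * (eta C B * eta D B)) - (\<Sum>f\<in>D. \<Sum>B\<in>Pow E. W B * (eta C B * eta {f} B))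
     - (\<Sum>e\<in>C. \<Sum>B\<in>Pow E. W B * (eta {e} B * eta D B)) + (\<Sum>e\<in>C. \<Sum>f\<in>D. \<Sum>B\<in>Pow E. W B * (eta {e} B * eta {f} B))"
  proof -
    have "W B * (chi C B * chi D B) = W B * (eta C B * eta D B) - (\<Sum>f\<in>D. W B * (eta C B * eta {f} B))
     - (\<Sum>e\<in>C. W B * (eta {e} B * eta D B)) + (\<Sum>e\<in>C. \<Sum>f\<in>D. W B * (eta {e} B * eta {f} B))" for B
    proof -
      have 1: "(\<Sum>f\<in>D. W B * (eta C B * eta {f} B)) = W B * (eta C B * (\<Sum>f\<in>D. eta {f} B))"
        by (simp add: sum_distrib_left)
      have 2: "(\<Sum>e\<in>C. W B * (eta {e} B * eta D B)) = W B * ((\<Sum>e\<in>C. eta {e} B) * eta D B)"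
        by (simp add: sum_distrib_left sum_distrib_right)
      have 3: "(\<Sum>e\<in>C. \<Sum>f\<in>D. W B * (eta {e} B * eta {f} B)) = W B * ((\<Sum>e\<in>C. eta {e} B) * (\<Sum>f\<in>D. eta {f} B))"
        unfolding sum_product by (simp add: sum_distrib_left)
      show ?thesis unfolding 1 2 3 chi_def by (simp only: algebra_simps)
    qed
    then have "(\<Sum>B\<in>Pow E. W B * (chi C B * chi D B)) =
     (\<Sum>B\<in>Pow E. W B * (eta C B * eta D B)) - (\<Sum>B\<in>Pow E. \<Sum>f\<in>D. W B * (eta C B * eta {f} B))
     - (\<Sum>B\<in>Pow E. \<Sum>e\<in>C. W B * (eta {e} B * eta D B)) + (\<Sum>B\<in>Pow E. \<Sum>e\<in>C. \<Sum>f\<in>D. W B * (eta {e} B * eta {f} B))"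
      by (simp only: sum.distrib sum_subtractf)
    moreover have "(\<Sum>B\<in>Pow E. \<Sum>f\<in>D. W B * (eta C B * eta {f} B)) = (\<Sum>f\<in>D. \<Sum>B\<in>Pow E. W B * (eta C B * eta {f} B))"
      by (rule sum.swap)
    moreover have "(\<Sum>B\<in>Pow E. \<Sum>e\<in>C. W B * (eta {e} B * eta D B)) = (\<Sum>e\<in>C. \<Sum>B\<in>Pow E. W B * (eta {e} B * eta D B))"
      by (rule sum.swap)
    moreover have "(\<Sum>B\<in>Pow E. \<Sum>e\<in>C. \<Sum>f\<in>D. W B * (eta {e} B * eta {f} B)) = (\<Sum>e\<in>C. \<Sum>f\<in>D. \<Sum>B\<in>Pow E. W B * (eta {e} B * eta {f} B))"
      by (subst sum.swap, intro sum.cong refl, rule sum.swap)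
    ultimately show ?thesis by (simp only:)
  qed
  have a: "(\<Sum>f\<in>D. \<Sum>B\<in>Pow E. W B * (eta C B * eta {f} B)) = real (card (C \<inter> D)) * (1 / p - 1)"
  proof -
    have "(\<Sum>f\<in>D. \<Sum>B\<in>Pow E. W B * (eta C B * eta {f} B)) = (\<Sum>f\<in>D. (1 / p) ^ card ({f} \<inter> C) - 1)"
      using assms by (intro sum.cong refl) (subst sum_W_eta_eta, auto simp: Int_commute)
    then show ?thesis using single[OF fin(2), of C] by (simp add: Int_commute)
  qed
  have b: "(\<Sum>e\<in>C. \<Sum>B\<in>Pow E. W B * (eta {e} B * eta D B)) = real (card (C \<inter> D)) * (1 / p - 1)"
  proof -
    have "(\<Sum>e\<in>C. \<Sum>B\<in>Pow E. W B * (eta {e} B * eta D B)) = (\<Sum>e\<in>C. (1 / p) ^ card ({e} \<inter> D) - 1)"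
      using assms by (intro sum.cong refl) (subst sum_W_eta_eta, auto)
    then show ?thesis using single[OF fin(1), of D] by simp
  qed
  have c: "(\<Sum>e\<in>C. \<Sum>f\<in>D. \<Sum>B\<in>Pow E. W B * (eta {e} B * eta {f} B)) = real (card (C \<inter> D)) * (1 / p - 1)"
  proof -
    have "(\<Sum>f\<in>D. \<Sum>B\<in>Pow E. W B * (eta {e} B * eta {f} B)) = (1 / p) ^ card ({e} \<inter> D) - 1" if "e \<in> C" for e
    proof -
      have "(\<Sum>f\<in>D. \<Sum>B\<in>Pow E. W B * (eta {e} B * eta {f} B)) = (\<Sum>f\<in>D. (1 / p) ^ card ({f} \<inter> {e}) - 1)"
        using assms that by (intro sum.cong refl) (subst sum_W_eta_eta, auto simp: Int_commute)
      also have "\<dots> = real (card (D \<inter> {e})) * (1 / p - 1)"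
        by (rule single[OF fin(2)])
      finally show ?thesis by (cases "e \<in> D") auto
    qed
    then show ?thesis using single[OF fin(1), of D] by simp
  qed
  show ?thesis
    unfolding * a b c sum_W_eta_eta[OF assms] by simp
qed

lemma moebius_smooth_excess:
  assumes "B \<subseteq> E" "C \<subseteq> E"
  shows "moebius_inv (\<lambda>A. (1 - p) ^ card (E - A) * excess C A) B = W B * chi C B"
proof -
  have fin: "finite C" using assms E finite_subset by auto
  define h where "h X A = (1 - p) ^ card (E - A) * of_bool (X \<subseteq> A)" for X A :: "'a set"
  have h: "moebius_inv (\<lambda>A. h X A - h {} A) B = W B * eta X B" if "X \<subseteq> E" for X
    using moebius_smooth_superset[OF assms(1) that] moebius_smooth_superset[OF assms(1), of "{}"]
    unfolding moebius_diff h_def by (simp add: eta_def algebra_simps)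
  have "(\<lambda>A. (1 - p) ^ card (E - A) * excess C A) = (\<lambda>A. (h C A - h {} A) - (\<Sum>e\<in>C. h {e} A - h {} A))"
    unfolding excess_altdef[OF fin] h_def by (auto simp: fun_eq_iff algebra_simps sum_distrib_left)
  then have "moebius_inv (\<lambda>A. (1 - p) ^ card (E - A) * excess C A) B =
    moebius_inv (\<lambda>A. h C A - h {} A) B - (\<Sum>e\<in>C. moebius_inv (\<lambda>A. h {e} A - h {} A) B)"
    by (simp only: moebius_diff[of "\<lambda>A. h C A - h {} A" "\<lambda>A. \<Sum>e\<in>C. h {e} A - h {} A"] moebius_sum)
  also have "\<dots> = W B * eta C B - (\<Sum>e\<in>C. W B * eta {e} B)"
    using assms(2) h by (intro arg_cong2[where f = "(-)"] sum.cong) auto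
  finally show ?thesis by (simp add: chi_def sum_distrib_left algebra_simps)
qed

text \<open>The \<open>L\<^sup>1\<close> norm is bounded by the \<open>L\<^sup>2\<close> norm with respect to the Bernoulli product measure, in which
  only pairs of blocks with at least two common elements are correlated.\<close>

lemma mnorm_smooth_excess_le:
  assumes I: "finite I" "\<And>i. i \<in> I \<Longrightarrow> C i \<subseteq> E"
  shows "mnorm E (\<lambda>A. (1 - p) ^ card (E - A) * (\<Sum>i\<in>I. w i * excess (C i) A)) \<le>
    sqrt (\<Sum>i\<in>I. \<Sum>j\<in>I. w i * w j *
      ((1 / p) ^ card (C i \<inter> C j) - 1 - real (card (C i \<inter> C j)) * (1 / p - 1)))"
proof -
  define x where "x B = (\<Sum>i\<in>I. w i * chi (C i) B)" for B
  define m where "m = (\<Sum>B\<in>Pow E. W B * \<bar>x B\<bar>)"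
  have "moebius_inv (\<lambda>A. (1 - p) ^ card (E - A) * (\<Sum>i\<in>I. w i * excess (C i) A)) B = W B * x B"
    if "B \<subseteq> E" for B
  proof -
    have "(\<lambda>A. (1 - p) ^ card (E - A) * (\<Sum>i\<in>I. w i * excess (C i) A)) =
      (\<lambda>A. \<Sum>i\<in>I. w i * ((1 - p) ^ card (E - A) * excess (C i) A))"
      by (simp add: sum_distrib_left mult_ac)
    then have "moebius_inv (\<lambda>A. (1 - p) ^ card (E - A) * (\<Sum>i\<in>I. w i * excess (C i) A)) B =
      (\<Sum>i\<in>I. w i * moebius_inv (\<lambda>A. (1 - p) ^ card (E - A) * excess (C i) A) B)"
      by (simp only: moebius_sum moebius_cmult)
    then show ?thesis
      using moebius_smooth_excess[OF that I(2)] by (simp add: x_def sum_distrib_left mult_ac)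
  qed
  then have "mnorm E (\<lambda>A. (1 - p) ^ card (E - A) * (\<Sum>i\<in>I. w i * excess (C i) A)) = m"
    unfolding mnorm_def m_def by (intro sum.cong refl) (auto simp: abs_mult W_nonneg)
  \<comment> \<open>Cauchy-Schwarz: the variance of \<open>\<bar>x B\<bar>\<close> under the
    probability weights \<open>W\<close> is non-negative.\<close>
  moreover have "m\<^sup>2 \<le> (\<Sum>B\<in>Pow E. W B * (x B)\<^sup>2)"
  proof -
    have W1: "(\<Sum>B\<in>Pow E. W B) = 1"
      using sum_W_superset[of "{}" E] by simp
    have "0 \<le> (\<Sum>B\<in>Pow E. W B * (\<bar>x B\<bar> - m)\<^sup>2)"
      by (intro sum_nonneg mult_nonneg_nonneg W_nonneg) auto
    also have "\<dots> = (\<Sum>B\<in>Pow E. W B * (x B)\<^sup>2 - 2 * m * (W B * \<bar>x B\<bar>) + m\<^sup>2 * W B)"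
      by (intro sum.cong refl) (simp add: power2_diff algebra_simps)
    also have "\<dots> = (\<Sum>B\<in>Pow E. W B * (x B)\<^sup>2) - 2 * m * m + m\<^sup>2 * 1"
      unfolding sum.distrib sum_subtractf sum_distrib_left[symmetric] W1 m_def by simp
    finally show ?thesis by (simp add: power2_eq_square)
  qed
  moreover have "(\<Sum>B\<in>Pow E. W B * (x B)\<^sup>2) = (\<Sum>i\<in>I. \<Sum>j\<in>I. w i * w j *
      ((1 / p) ^ card (C i \<inter> C j) - 1 - real (card (C i \<inter> C j)) * (1 / p - 1)))"
  proof -
    have "(\<Sum>B\<in>Pow E. W B * (x B)\<^sup>2) = (\<Sum>B\<in>Pow E. \<Sum>i\<in>I. \<Sum>j\<in>I. w i * w j * (W B * (chi (C i) B * chi (C j) B)))"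
      unfolding x_def power2_eq_square sum_product by (intro sum.cong refl) (simp add: sum_distrib_left mult_ac)
    also have "\<dots> = (\<Sum>i\<in>I. \<Sum>j\<in>I. \<Sum>B\<in>Pow E. w i * w j * (W B * (chi (C i) B * chi (C j) B)))"
      by (subst sum.swap, intro sum.cong refl, rule sum.swap)
    also have "\<dots> = (\<Sum>i\<in>I. \<Sum>j\<in>I. w i * w j * (\<Sum>B\<in>Pow E. W B * (chi (C i) B * chi (C j) B)))"
      by (simp only: sum_distrib_left)
    also have "\<dots> = (\<Sum>i\<in>I. \<Sum>j\<in>I. w i * w j *
      ((1 / p) ^ card (C i \<inter> C j) - 1 - real (card (C i \<inter> C j)) * (1 / p - 1)))"
      by (intro sum.cong refl arg_cong2[where f = "(*)"] sum_W_chi_chi I)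
    finally show ?thesis .
  qed
  ultimately show ?thesis
    using real_le_rsqrt by metis
qed

end

text \<open>A crude bound without \<open>p\<close>, for blocks so large that the powers of
  \<open>1 / p\<close> in the second moment are out of control.\<close>

lemma mnorm_excess_le:
  assumes "finite E" "C \<subseteq> E"
  shows "mnorm E (excess C) \<le> 2 + 2 * real (card C)"
proof -
  have fin: "finite C" using assms finite_subset by auto
  have sup: "mnorm E (\<lambda>A. of_bool (X \<subseteq> A) - 1) \<le> 2" for X
    using mnorm_diff[of E "\<lambda>A. of_bool (X \<subseteq> A)" "\<lambda>A. 1"] mnorm_superset_le[OF assms(1), of X]
      mnorm_superset_le[OF assms(1), of "{}"] by simp
  have "mnorm E (excess C) = mnorm E (\<lambda>A. (of_bool (C \<subseteq> A) - 1) - (\<Sum>e\<in>C. of_bool ({e} \<subseteq> A) - 1))"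
    by (rule mnorm_cong) (simp only: excess_altdef[OF fin])
  also have "\<dots> \<le> mnorm E (\<lambda>A. of_bool (C \<subseteq> A) - 1) + mnorm E (\<lambda>A. \<Sum>e\<in>C. of_bool ({e} \<subseteq> A) - 1)"
    by (rule mnorm_diff)
  also have "\<dots> \<le> 2 + (\<Sum>e\<in>C. 2)"
    by (intro add_mono sup order_trans[OF mnorm_sum sum_mono])
  finally show ?thesis by simp
qed

text \<open>The mean value theorem in \<open>t\<close> for \<open>exp (L A + t * G A)\<close>,
  paired with the signs of the Moebius inverse of the increment. The signs turn the norm of the
  increment into the increment of a real function; having absolute value at most one, they bound its
  derivative by a norm.\<close>

lemma mnorm_exp_diff_le:
  assumes E: "finite E"
    and bound: "\<And>t. 0 \<le> t \<Longrightarrow> t \<le> 1 \<Longrightarrow> mnorm E (\<lambda>A. G A * exp (L A + t * G A)) \<le> c"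
  shows "mnorm E (\<lambda>A. exp (L A + G A) - exp (L A)) \<le> c"
proof -
  define s where "s A = sgn (moebius_inv (\<lambda>A. exp (L A + G A) - exp (L A)) A)" for A
  define \<phi> where "\<phi> t = (\<Sum>A\<in>Pow E. s A * moebius_inv (\<lambda>A. exp (L A + t * G A)) A)" for t
  define \<phi>' where "\<phi>' t = (\<Sum>A\<in>Pow E. s A * moebius_inv (\<lambda>A. G A * exp (L A + t * G A)) A)" for t
  have "(\<phi> has_real_derivative \<phi>' t) (at t)" for t
    unfolding \<phi>_def \<phi>'_def moebius_inv_def
    by (intro DERIV_sum DERIV_cmult) (auto intro!: derivative_eq_intros)
  then obtain z where z: "0 < z" "z < 1" "\<phi> 1 - \<phi> 0 = (1 - 0) * \<phi>' z"
    using MVT2[of 0 1 \<phi> \<phi>'] by auto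
  have "mnorm E (\<lambda>A. exp (L A + G A) - exp (L A)) = \<phi> 1 - \<phi> 0"
    unfolding mnorm_def \<phi>_def sum_subtractf[symmetric] right_diff_distrib[symmetric] moebius_diff[symmetric]
    by (intro sum.cong refl) (simp add: s_def abs_sgn mult.commute)
  also have "\<dots> = \<phi>' z" using z by simp
  also have "\<dots> \<le> mnorm E (\<lambda>A. G A * exp (L A + z * G A))"
    unfolding \<phi>'_def mnorm_def
  proof (rule sum_mono)
    fix A
    have "\<bar>s A\<bar> \<le> 1" by (simp add: s_def sgn_if)
    then have "\<bar>s A * moebius_inv (\<lambda>A. G A * exp (L A + z * G A)) A\<bar> \<le> \<bar>moebius_inv (\<lambda>A. G A * exp (L A + z * G A)) A\<bar>"
      unfolding abs_mult by (intro mult_left_le_one_le) auto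
    then show "s A * moebius_inv (\<lambda>A. G A * exp (L A + z * G A)) A \<le> \<bar>moebius_inv (\<lambda>A. G A * exp (L A + z * G A)) A\<bar>"
      by linarith
  qed
  also have "\<dots> \<le> c" using bound z by simp
  finally show ?thesis .
qed

section \<open>The laws of the two random graphs\<close>

lemma measure_pmf_finite_support:
  assumes "set_pmf P \<subseteq> F" "finite F"
  shows "measure_pmf.prob P Z = (\<Sum>x\<in>F. pmf P x * of_bool (x \<in> Z))"
proof -
  have "measure_pmf.prob P Z = measure_pmf.prob P (F \<inter> Z)"
    using assms by (intro measure_pmf.finite_measure_eq_AE) (auto simp: AE_measure_pmf_iff)
  also have "\<dots> = (\<Sum>x\<in>F \<inter> Z. pmf P x)"
    using assms by (intro measure_measure_pmf_finite) auto
  also have "\<dots> = (\<Sum>x\<in>F. pmf P x * of_bool (x \<in> Z))"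
    using assms by (intro sum.mono_neutral_cong_left) auto
  finally show ?thesis .
qed

lemma moebius_prob_Pow:
  assumes "finite A"
  shows "moebius_inv (\<lambda>A. measure_pmf.prob P (Pow A)) A = pmf P A"
  using assms by (intro moebius_unique) (auto simp: measure_measure_pmf_finite finite_subset)

text \<open>The point masses within an event are dominated by the sum of all absolute differences;
  the factor two given up here does not affect the limit.\<close>

lemma tv_dist_le_mnorm:
  assumes E: "finite E" and P: "set_pmf P \<subseteq> Pow E" and Q: "set_pmf Q \<subseteq> Pow E"
  shows "tv_dist P Q \<le> mnorm E (\<lambda>A. measure_pmf.prob P (Pow A) - measure_pmf.prob Q (Pow A))"
  unfolding tv_dist_def
proof (rule cSUP_least)
  fix Z :: "'a set set"
  have "\<bar>measure_pmf.prob P Z - measure_pmf.prob Q Z\<bar> = \<bar>\<Sum>A\<in>Pow E. (pmf P A - pmf Q A) * of_bool (A \<in> Z)\<bar>"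
    using E by (simp only: measure_pmf_finite_support[OF P] measure_pmf_finite_support[OF Q] finite_Pow_iff
        sum_subtractf left_diff_distrib)
  also have "\<dots> \<le> (\<Sum>A\<in>Pow E. \<bar>pmf P A - pmf Q A\<bar>)"
    by (rule order_trans[OF sum_abs sum_mono]) (auto simp: of_bool_def)
  also have "\<dots> = mnorm E (\<lambda>A. measure_pmf.prob P (Pow A) - measure_pmf.prob Q (Pow A))"
    unfolding mnorm_def moebius_diff
    by (intro sum.cong refl) (use E in \<open>auto simp: moebius_prob_Pow finite_subset\<close>)
  finally show "\<bar>measure_pmf.prob P Z - measure_pmf.prob Q Z\<bar> \<le> \<dots>" .
qed auto

lemma tv_dist_nonneg: "0 \<le> tv_dist P Q"
  unfolding tv_dist_def
proof (rule cSUP_upper2[where x = "{}"])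
  show "bdd_above (range (\<lambda>A. \<bar>measure_pmf.prob P A - measure_pmf.prob Q A\<bar>))"
  proof (rule bdd_aboveI2)
    fix A
    show "\<bar>measure_pmf.prob P A - measure_pmf.prob Q A\<bar> \<le> 1"
      using measure_pmf.prob_le_1[of P A] measure_pmf.prob_le_1[of Q A]
        measure_nonneg[of "measure_pmf P" A] measure_nonneg[of "measure_pmf Q" A] by linarith
  qed
qed auto

lemma prob_pair_pmf_Times:
  "measure_pmf.prob (pair_pmf M N) (A \<times> B) = measure_pmf.prob M A * measure_pmf.prob N B"
proof -
  \<comment> \<open>Intersecting with the supports makes both sets countable.\<close>
  have "measure_pmf.prob (pair_pmf M N) (A \<times> B) = measure_pmf.prob (pair_pmf M N) ((A \<inter> set_pmf M) \<times> (B \<inter> set_pmf N))"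
    by (intro measure_pmf.finite_measure_eq_AE) (auto simp: AE_measure_pmf_iff)
  also have "\<dots> = measure_pmf.prob M (A \<inter> set_pmf M) * measure_pmf.prob N (B \<inter> set_pmf N)"
    by (rule measure_pmf_prob_product) auto
  finally show ?thesis by (simp add: measure_Int_set_pmf)
qed

section \<open>Random subsets and the two random graphs\<close>

lemma prob_random_subset_disjoint:
  assumes "finite X" "0 \<le> p" "p \<le> 1"
  shows "measure_pmf.prob (random_subset X p) {S. S \<inter> Y = {}} = (1 - p) ^ card (X \<inter> Y)"
proof -
  have "(\<lambda>f. {x \<in> X. f x}) -` {S. S \<inter> Y = {}} = Pi X (\<lambda>x. if x \<in> Y then {False} else UNIV)"
    by (auto simp: Pi_def split: if_splits)
  then have "measure_pmf.prob (random_subset X p) {S. S \<inter> Y = {}} =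
    (\<Prod>x\<in>X. measure_pmf.prob (bernoulli_pmf p) (if x \<in> Y then {False} else UNIV))"
    using assms by (simp add: random_subset_def measure_Pi_pmf_Pi)
  also have "\<dots> = (\<Prod>x\<in>X. if x \<in> Y then 1 - p else 1)"
    using assms by (intro prod.cong refl) (auto simp: measure_pmf_single)
  also have "\<dots> = (\<Prod>x\<in>X \<inter> Y. 1 - p)"
    using assms by (simp only: prod.inter_restrict)
  finally show ?thesis by simp
qed

lemma set_random_subset: "finite X \<Longrightarrow> set_pmf (random_subset X p) \<subseteq> Pow X"
  by (auto simp: random_subset_def)

lemma pmf_random_subset:
  assumes "finite X" "0 \<le> p" "p \<le> 1" "S \<subseteq> X"
  shows "pmf (random_subset X p) S = (\<Prod>x\<in>X. if x \<in> S then p else 1 - p)"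
proof -
  have "(\<lambda>f. {x \<in> X. f x}) -` {S} = Pi X (\<lambda>x. {x \<in> S})"
    using assms(4) by (auto simp: Pi_def)
  then have "pmf (random_subset X p) S = (\<Prod>x\<in>X. measure_pmf.prob (bernoulli_pmf p) {x \<in> S})"
    using assms by (simp add: random_subset_def pmf_map measure_Pi_pmf_Pi)
  also have "\<dots> = (\<Prod>x\<in>X. if x \<in> S then p else 1 - p)"
    using assms by (intro prod.cong refl) (auto simp: measure_pmf_single)
  finally show ?thesis .
qed

lemma pmf_random_subset':
  assumes "finite X" "0 \<le> p" "p \<le> 1" "S \<subseteq> X"
  shows "pmf (random_subset X p) S = p ^ card S * (1 - p) ^ card (X - S)"
proof -
  have "(\<Prod>x\<in>X. if x \<in> S then p else 1 - p) = (\<Prod>x\<in>S. p) * (\<Prod>x\<in>X - S. 1 - p)"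
    using assms by (simp add: prod.If_cases Int_absorb1 Diff_eq)
  then show ?thesis using pmf_random_subset[OF assms] by simp
qed

text \<open>The graph lies in \<open>A\<close> exactly when \<open>G\<close> avoids the edges
  outside \<open>A\<close> and \<open>T\<close> avoids the triangles with an edge outside
  \<open>A\<close>; these events are independent.\<close>

lemma RGT_subset:
  assumes A: "A \<subseteq> nsets {1..n} 2" and p: "0 \<le> p" "p \<le> 1" "0 \<le> p'" "p' \<le> 1"
  shows "measure_pmf.prob (RGT n p p') (Pow A) =
    (1 - p) ^ card (nsets {1..n} 2 - A) * (1 - p') ^ card {t \<in> nsets {1..n} 3. \<not> nsets t 2 \<subseteq> A}"
proof -
  have "(\<lambda>(G, T). G \<union> (\<Union>t\<in>T. nsets t 2)) -` Pow A = {G. G \<inter> - A = {}} \<times> {T. T \<inter> {t. \<not> nsets t 2 \<subseteq> A} = {}}"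
  proof -
    have "T \<inter> {t. \<not> nsets t 2 \<subseteq> A} = {} \<longleftrightarrow> (\<forall>t\<in>T. nsets t 2 \<subseteq> A)" for T :: "nat set set"
      by blast
    moreover have "G \<inter> - A = {} \<longleftrightarrow> G \<subseteq> A" for G
      by blast
    ultimately show ?thesis
      by (intro set_eqI) (simp only: vimage_eq split_beta Pow_iff Un_subset_iff UN_subset_iff mem_Times_iff mem_Collect_eq)
  qed
  then have "measure_pmf.prob (RGT n p p') (Pow A) =
    measure_pmf.prob (erdos_renyi n p) {G. G \<inter> - A = {}} *
    measure_pmf.prob (random_subset (nsets {1..n} 3) p') {T. T \<inter> {t. \<not> nsets t 2 \<subseteq> A} = {}}"
    by (simp add: RGT_def prob_pair_pmf_Times)
  also have "\<dots> = (1 - p) ^ card (nsets {1..n} 2 \<inter> - A) * (1 - p') ^ card (nsets {1..n} 3 \<inter> {t. \<not> nsets t 2 \<subseteq> A})"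
    unfolding erdos_renyi_def
    by (simp only: prob_random_subset_disjoint finite_imp_finite_nsets finite_atLeastAtMost p)
  also have "nsets {1..n} 2 \<inter> - A = nsets {1..n} 2 - A" by (rule Diff_eq[symmetric])
  also have "nsets {1..n} 3 \<inter> {t. \<not> nsets t 2 \<subseteq> A} = {t \<in> nsets {1..n} 3. \<not> nsets t 2 \<subseteq> A}" by blast
  finally show ?thesis .
qed

lemma set_RGT: "set_pmf (RGT n p p') \<subseteq> Pow (nsets {1..n} 2)"
proof -
  have "G \<union> (\<Union>t\<in>T. nsets t 2) \<subseteq> nsets {1..n} 2"
    if "G \<subseteq> nsets {1..n} 2" "T \<subseteq> nsets {1..n} 3" for G :: "nat set set" and T
    using that by (force simp: nsets_def)
  moreover have "set_pmf (random_subset (nsets {1..n} k) r) \<subseteq> Pow (nsets {1..n} k)" for k r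
    by (intro set_random_subset finite_imp_finite_nsets) auto
  ultimately show ?thesis
    unfolding RGT_def erdos_renyi_def by (simp only: set_map_pmf set_pair_pmf) fast
qed

lemma set_RIG: "set_pmf (RIG n d \<delta>) \<subseteq> Pow (nsets {1..n} 2)"
  by (auto simp: RIG_def intersection_graph_def)

text \<open>An element \<open>k\<close> joins all the vertices whose sets contain it, so the graph
  is the union of one clique for each \<open>k\<close>.\<close>

lemma intersection_graph_subset_iff:
  assumes "\<And>i. i \<in> {1..n} \<Longrightarrow> S i \<subseteq> Y"
  shows "intersection_graph n S \<subseteq> A \<longleftrightarrow> (\<forall>k\<in>Y. nsets {i \<in> {1..n}. k \<in> S i} 2 \<subseteq> A)"
proof
  assume "intersection_graph n S \<subseteq> A"
  then show "\<forall>k\<in>Y. nsets {i \<in> {1..n}. k \<in> S i} 2 \<subseteq> A"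
    unfolding intersection_graph_def nsets_2_eq by blast
next
  assume *: "\<forall>k\<in>Y. nsets {i \<in> {1..n}. k \<in> S i} 2 \<subseteq> A"
  show "intersection_graph n S \<subseteq> A"
  proof
    fix e assume "e \<in> intersection_graph n S"
    then obtain i j k where ij: "e = {i, j}" "i \<in> {1..n}" "j \<in> {1..n}" "i \<noteq> j" "k \<in> S i" "k \<in> S j"
      by (auto simp: intersection_graph_def)
    then have "k \<in> Y" "e \<in> nsets {i \<in> {1..n}. k \<in> S i} 2"
      using assms by auto
    then show "e \<in> A" using * by blast
  qed
qed

text \<open>Exchanging the roles of the \<open>n\<close> vertices and the \<open>d\<close> elements: the graph is the union of \<open>d\<close>
  independent cliques on random vertex sets.\<close>

lemma RIG_subset:
  assumes \<delta>: "0 \<le> \<delta>" "\<delta> \<le> 1"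
  shows "measure_pmf.prob (RIG n d \<delta>) (Pow A) =
    (\<Sum>V\<in>Pow {1..n}. \<delta> ^ card V * (1 - \<delta>) ^ card ({1..n} - V) * of_bool (nsets V 2 \<subseteq> A)) ^ d"
proof -
  define X Y where "X = {1..n}" and "Y = {1..d}"
  have fin: "finite X" "finite Y" by (auto simp: X_def Y_def)
  \<comment> \<open>\<open>flip\<close> transposes the incidence relation between \<open>X\<close>
    and \<open>Y\<close>. Outside \<open>Y\<close> it returns the default value \<open>{}\<close> of
    \<open>Pi_pmf\<close>, so that transposing twice gives back every family in
    \<open>F X Y\<close>.\<close>
  define flip :: "nat set \<Rightarrow> nat set \<Rightarrow> (nat \<Rightarrow> nat set) \<Rightarrow> nat \<Rightarrow> nat set"
    where "flip X Y S k = (if k \<in> Y then {i \<in> X. k \<in> S i} else {})" for X Y S k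
  define P where "P X Y = Pi_pmf X {} (\<lambda>_::nat. random_subset (Y :: nat set) \<delta>)" for X Y
  define F :: "nat set \<Rightarrow> nat set \<Rightarrow> (nat \<Rightarrow> nat set) set" where "F X Y = PiE_dflt X {} (\<lambda>_. Pow Y)" for X Y
  have F: "set_pmf (P X Y) \<subseteq> F X Y" "finite (F X Y)" if "finite X" "finite Y" for X Y
  proof -
    have "set_pmf (P X Y) \<subseteq> PiE_dflt X {} (set_pmf \<circ> (\<lambda>_. random_subset Y \<delta>))"
      unfolding P_def using that by (intro set_Pi_pmf_subset')
    also have "\<dots> \<subseteq> F X Y"
      using set_random_subset[OF that(2), of \<delta>] by (auto simp: F_def PiE_dflt_def)
    finally show "set_pmf (P X Y) \<subseteq> F X Y" .
    show "finite (F X Y)" unfolding F_def using that by auto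
  qed
  have flipF: "flip X Y S \<in> F Y X" if "S \<in> F X Y" for S X Y
    by (auto simp: F_def flip_def PiE_dflt_def)
  have flipflip: "flip Y X (flip X Y S) = S" if "S \<in> F X Y" for S X Y
    using that by (fastforce simp: F_def flip_def PiE_dflt_def fun_eq_iff)
  have pmf_P: "pmf (P X Y) S = (\<Prod>i\<in>X. \<Prod>k\<in>Y. if k \<in> S i then \<delta> else 1 - \<delta>)"
    if "S \<in> F X Y" "finite X" "finite Y" for S X Y
    using that unfolding P_def F_def
    by (subst pmf_Pi') (auto simp: PiE_dflt_def \<delta> pmf_random_subset intro!: prod.cong)
  \<comment> \<open>By \<open>pmf_P\<close> both sides are the same double product over incidence
    pairs, taken in the two orders.\<close>
  have pmf_flip: "pmf (P Y X) (flip X Y S) = pmf (P X Y) S" if "S \<in> F X Y" for S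
    unfolding pmf_P[OF that fin] pmf_P[OF flipF[OF that] fin(2,1)]
    by (subst prod.swap) (auto simp: flip_def intro!: prod.cong)
  have "measure_pmf.prob (RIG n d \<delta>) (Pow A) = measure_pmf.prob (P X Y) {S. intersection_graph n S \<subseteq> A}"
    by (simp add: RIG_def P_def X_def Y_def vimage_def)
  also have "\<dots> = (\<Sum>S\<in>F X Y. pmf (P X Y) S * of_bool (S \<in> {S. intersection_graph n S \<subseteq> A}))"
    by (rule measure_pmf_finite_support[OF F[OF fin]])
  also have "\<dots> = (\<Sum>T\<in>F Y X. pmf (P Y X) T * of_bool (T \<in> Pi Y (\<lambda>_. {V. nsets V 2 \<subseteq> A})))"
  proof (rule sum.reindex_bij_witness[of _ "flip Y X" "flip X Y"])
    fix S assume S: "S \<in> F X Y"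
    have "intersection_graph n S \<subseteq> A \<longleftrightarrow> flip X Y S \<in> Pi Y (\<lambda>_. {V. nsets V 2 \<subseteq> A})"
      using S by (subst intersection_graph_subset_iff[of n S Y]) (auto simp: flip_def X_def F_def PiE_dflt_def Pi_def)
    then show "pmf (P Y X) (flip X Y S) * of_bool (flip X Y S \<in> Pi Y (\<lambda>_. {V. nsets V 2 \<subseteq> A})) =
        pmf (P X Y) S * of_bool (S \<in> {S. intersection_graph n S \<subseteq> A})"
      by (simp add: pmf_flip[OF S])
  qed (auto simp: flipF flipflip)
  also have "\<dots> = measure_pmf.prob (P Y X) (Pi Y (\<lambda>_. {V. nsets V 2 \<subseteq> A}))"
    by (rule measure_pmf_finite_support[OF F[OF fin(2,1)], symmetric])
  also have "\<dots> = measure_pmf.prob (random_subset X \<delta>) {V. nsets V 2 \<subseteq> A} ^ d"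
    unfolding P_def using fin by (subst measure_Pi_pmf_Pi) (auto simp: Y_def)
  also have "measure_pmf.prob (random_subset X \<delta>) {V. nsets V 2 \<subseteq> A} =
    (\<Sum>V\<in>Pow X. pmf (random_subset X \<delta>) V * of_bool (V \<in> {V. nsets V 2 \<subseteq> A}))"
    using fin set_random_subset by (intro measure_pmf_finite_support) auto
  also have "\<dots> = (\<Sum>V\<in>Pow X. \<delta> ^ card V * (1 - \<delta>) ^ card (X - V) * of_bool (nsets V 2 \<subseteq> A))"
    using fin \<delta> by (intro sum.cong) (auto simp: pmf_random_subset')
  finally show ?thesis by (simp add: X_def)
qed

section \<open>Cliques on random vertex sets\<close>

definition subset_prob :: "'a set \<Rightarrow> real \<Rightarrow> 'a set \<Rightarrow> real" where
  "subset_prob X \<delta> V = \<delta> ^ card V * (1 - \<delta>) ^ card (X - V)"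

section \<open>Weights of random vertex sets\<close>

locale random_subset_weights =
  fixes X :: "'a set" and n :: nat and \<delta> :: real
  assumes X: "finite X" "card X = n" and \<delta>: "0 \<le> \<delta>" "\<delta> \<le> 1"
begin

abbreviation w where "w \<equiv> subset_prob X \<delta>"

lemma w_nonneg: "0 \<le> w V"
  using \<delta> by (simp add: subset_prob_def)

lemma w_card:
  assumes "V \<in> nsets X k"
  shows "w V = \<delta> ^ k * (1 - \<delta>) ^ (n - k)"
  using assms X by (auto simp: subset_prob_def nsets_def card_Diff_subset)

lemma sum_w_superset:
  assumes "T \<subseteq> X"
  shows "(\<Sum>V | T \<subseteq> V \<and> V \<subseteq> X. w V) = \<delta> ^ card T"
  using sum_between_power[OF X(1) assms order_refl, of \<delta> "1 - \<delta>"] by (simp add: subset_prob_def)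

lemma sum_w: "(\<Sum>V\<in>Pow X. w V) = 1"
  using sum_w_superset[of "{}"] by (simp add: Pow_def)

text \<open>Union bound over the at most \<open>n ^ k\<close> sets with \<open>k\<close> elements,
  each of which lies in the random set with probability \<open>\<delta> ^ k\<close>.\<close>

lemma sum_w_card_ge: "(\<Sum>V | V \<subseteq> X \<and> k \<le> card V. w V) \<le> (real n * \<delta>) ^ k"
proof -
  have fin: "finite (nsets X k)" using X by (simp add: finite_imp_finite_nsets)
  have "(\<Sum>V | V \<subseteq> X \<and> k \<le> card V. w V) \<le> (\<Sum>V\<in>Pow X. \<Sum>T\<in>nsets X k. of_bool (T \<subseteq> V) * w V)"
  proof (rule sum_le_included[where i = id])
    show "\<forall>V\<in>{V. V \<subseteq> X \<and> k \<le> card V}. \<exists>V'\<in>Pow X. id V' = V \<and> w V \<le> (\<Sum>T\<in>nsets X k. of_bool (T \<subseteq> V') * w V')"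
    proof
      fix V assume V: "V \<in> {V. V \<subseteq> X \<and> k \<le> card V}"
      then obtain T where T: "T \<subseteq> V" "card T = k" "finite T"
        using obtain_subset_with_card_n by blast
      then have "T \<in> nsets X k" using V by (auto simp: nsets_def)
      then have "of_bool (T \<subseteq> V) * w V \<le> (\<Sum>T\<in>nsets X k. of_bool (T \<subseteq> V) * w V)"
        using fin by (intro member_le_sum) (auto simp: w_nonneg)
      then show "\<exists>V'\<in>Pow X. id V' = V \<and> w V \<le> (\<Sum>T\<in>nsets X k. of_bool (T \<subseteq> V') * w V')"
        using T V by auto
    qed
  qed (use X in \<open>auto intro!: sum_nonneg simp: w_nonneg\<close>)
  also have "\<dots> = (\<Sum>T\<in>nsets X k. \<Sum>V\<in>Pow X. of_bool (T \<subseteq> V) * w V)"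
    by (rule sum.swap)
  also have "\<dots> = (\<Sum>T\<in>nsets X k. \<delta> ^ k)"
  proof (intro sum.cong refl)
    fix T assume T: "T \<in> nsets X k"
    have "(\<Sum>V\<in>Pow X. of_bool (T \<subseteq> V) * w V) = (\<Sum>V | T \<subseteq> V \<and> V \<subseteq> X. w V)"
      using X by (intro sum.mono_neutral_cong_right) auto
    then show "(\<Sum>V\<in>Pow X. of_bool (T \<subseteq> V) * w V) = \<delta> ^ k"
      using sum_w_superset[of T] T by (auto simp: nsets_def)
  qed
  also have "\<dots> = real (n choose k) * \<delta> ^ k"
    using X by simp
  also have "\<dots> \<le> real n ^ k * \<delta> ^ k"
  proof (intro mult_right_mono)
    have "n choose k \<le> n ^ k"
      by (cases "k \<le> n") (auto simp: binomial_le_pow binomial_eq_0)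
    then show "real (n choose k) \<le> real n ^ k"
      by (metis of_nat_le_iff of_nat_power)
  qed (use \<delta> in auto)
  finally show ?thesis by (simp add: power_mult_distrib)
qed

text \<open>Union bound over one further element \<open>v\<close> outside \<open>T\<close>.\<close>

lemma sum_w_superset_strict:
  assumes T: "T \<subseteq> X"
  shows "(\<Sum>V | T \<subset> V \<and> V \<subseteq> X. w V) \<le> real n * \<delta> ^ (card T + 1)"
proof -
  have finT: "finite T" using T X finite_subset by auto
  have "(\<Sum>V | T \<subset> V \<and> V \<subseteq> X. w V) \<le> (\<Sum>(v, V)\<in>(SIGMA v:X - T. {V. insert v T \<subseteq> V \<and> V \<subseteq> X}). w V)"
    by (rule sum_le_included[where i = snd]) (use X in \<open>force simp: w_nonneg\<close>)+
  also have "\<dots> = (\<Sum>v\<in>X - T. \<Sum>V | insert v T \<subseteq> V \<and> V \<subseteq> X. w V)"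
    using X by (subst sum.Sigma) auto
  also have "\<dots> = (\<Sum>v\<in>X - T. \<delta> ^ (card T + 1))"
  proof (intro sum.cong refl)
    fix v assume "v \<in> X - T"
    then show "(\<Sum>V | insert v T \<subseteq> V \<and> V \<subseteq> X. w V) = \<delta> ^ (card T + 1)"
      using sum_w_superset[of "insert v T"] T finT by simp
  qed
  also have "\<dots> = real (card (X - T)) * \<delta> ^ (card T + 1)" by simp
  also have "\<dots> \<le> real n * \<delta> ^ (card T + 1)"
    using X \<delta> by (intro mult_right_mono) (auto intro!: card_mono)
  finally show ?thesis .
qed

definition large_subsets where "large_subsets = {V. V \<subseteq> X \<and> 4 \<le> card V}"

lemma finite_large_subsets: "finite large_subsets"
  using X by (simp add: large_subsets_def)

text \<open>The probability that a given edge lies in a random set with at least four vertices: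
  \<open>\<delta> ^ 2\<close> less the cases of exactly two and exactly three vertices.\<close>

definition \<kappa> where "\<kappa> = \<delta>\<^sup>2 - \<delta>\<^sup>2 * (1 - \<delta>) ^ (n - 2) - (real n - 2) * \<delta> ^ 3 * (1 - \<delta>) ^ (n - 3)"

lemma sum_w_edge:
  assumes e: "e \<in> nsets X 2"
  shows "(\<Sum>V\<in>large_subsets. w V * of_bool (e \<subseteq> V)) = \<kappa>"
proof -
  have e': "e \<subseteq> X" "card e = 2" "finite e" using e by (auto simp: nsets_def)
  have n2: "2 \<le> n" using e' X card_mono by metis
  have ge2: "2 \<le> card V" if "e \<subseteq> V" "V \<subseteq> X" for V
    using that e' X finite_subset card_mono by metis
  have eq2: "V = e" if "e \<subseteq> V" "V \<subseteq> X" "card V = 2" for V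
    using that e' X finite_subset card_subset_eq by metis
  \<comment> \<open>The supersets of \<open>e\<close> with three vertices, one for each of the
    \<open>n - 2\<close> vertices outside \<open>e\<close>.\<close>
  define J where "J = (\<lambda>v. insert v e) ` (X - e)"
  have J: "J = {V. e \<subseteq> V \<and> V \<subseteq> X \<and> card V = 3}"
  proof
    show "J \<subseteq> {V. e \<subseteq> V \<and> V \<subseteq> X \<and> card V = 3}"
      using e' by (auto simp: J_def)
    show "{V. e \<subseteq> V \<and> V \<subseteq> X \<and> card V = 3} \<subseteq> J"
    proof
      fix V assume V: "V \<in> {V. e \<subseteq> V \<and> V \<subseteq> X \<and> card V = 3}"
      then have "card (V - e) = 1"
        using e' by (simp add: card_Diff_subset)
      then obtain v where "V - e = {v}" by (auto simp: card_1_singleton_iff)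
      then show "V \<in> J" using V unfolding J_def by blast
    qed
  qed
  have cardJ: "card J = n - 2"
  proof -
    have "inj_on (\<lambda>v. insert v e) (X - e)"
      by (auto simp: inj_on_def)
    then show ?thesis using e' X by (simp add: J_def card_image card_Diff_subset)
  qed
  have finJ: "finite J" using X by (simp add: J_def)
  have wJ: "w V = \<delta> ^ 3 * (1 - \<delta>) ^ (n - 3)" if "V \<in> J" for V
    using that J X by (intro w_card) (auto simp: nsets_def finite_subset)
  have we: "w e = \<delta>\<^sup>2 * (1 - \<delta>) ^ (n - 2)"
    using w_card[OF e] .
  have set: "{V. e \<subseteq> V \<and> V \<subseteq> X} = {e} \<union> J \<union> {V \<in> large_subsets. e \<subseteq> V}" (is "?L = ?R")
  proof
    show "?R \<subseteq> ?L" using e' by (auto simp: J large_subsets_def)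
    show "?L \<subseteq> ?R"
    proof
      fix V assume V: "V \<in> ?L"
      then have "card V = 2 \<or> card V = 3 \<or> 4 \<le> card V"
        using ge2[of V] by auto
      then show "V \<in> ?R" using V eq2[of V] by (auto simp: J large_subsets_def)
    qed
  qed
  have "\<delta>\<^sup>2 = (\<Sum>V\<in>?L. w V)"
    using sum_w_superset[OF e'(1)] e'(2) by simp
  also have "\<dots> = (\<Sum>V\<in>{e} \<union> J. w V) + (\<Sum>V | V \<in> large_subsets \<and> e \<subseteq> V. w V)"
    unfolding set using finJ finite_subset[OF Collect_restrict finite_large_subsets, of "\<lambda>V. e \<subseteq> V"] e'(2) by (intro sum.union_disjoint) (auto simp: J large_subsets_def)
  also have "(\<Sum>V\<in>{e} \<union> J. w V) = w e + (\<Sum>V\<in>J. w V)"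
    using finJ e'(2) by (subst sum.union_disjoint) (auto simp: J)
  also have "(\<Sum>V\<in>J. w V) = (real n - 2) * \<delta> ^ 3 * (1 - \<delta>) ^ (n - 3)"
    using wJ n2 by (simp add: cardJ of_nat_diff)
  also have "(\<Sum>V | V \<in> large_subsets \<and> e \<subseteq> V. w V) = (\<Sum>V\<in>large_subsets. w V * of_bool (e \<subseteq> V))"
    using finite_large_subsets by (intro sum.mono_neutral_cong_left) auto
  finally show ?thesis by (simp add: \<kappa>_def we)
qed

text \<open>An edge exists as \<open>2 \<le> n\<close>, and \<open>sum_w_edge\<close> then writes
  \<open>\<kappa>\<close> as a sum of weights.\<close>

lemma \<kappa>_nonneg:
  assumes "2 \<le> n"
  shows "0 \<le> \<kappa>"
proof -
  obtain e where "e \<subseteq> X" "card e = 2" "finite e"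
    using obtain_subset_with_card_n[of 2 X] assms X by auto
  then have "e \<in> nsets X 2" by (simp add: nsets_def)
  from sum_w_edge[OF this, symmetric] show ?thesis
    by (simp add: sum_nonneg w_nonneg)
qed

section \<open>Excess of the large cliques\<close>

abbreviation E where "E \<equiv> nsets X 2"

lemma finite_E: "finite E"
  using X by (simp add: finite_imp_finite_nsets)

lemma edges_subset: "V \<subseteq> X \<Longrightarrow> nsets V 2 \<subseteq> E"
  by (rule nsets_mono)

text \<open>Multiplied by \<open>d\<close>, this is the logarithm of the ratio of two transforms:
  cliques on the sets in \<open>J\<close> inserted as a whole, over the same cliques inserted edge
  by edge.\<close>

definition excess_sum where "excess_sum J A = (\<Sum>V\<in>J. w V * excess (nsets V 2) A)"

text \<open>
  Very large cliques are cut off because their \<open>L\<^sup>2\<close> contribution \<open>(1 / p) ^ (k choose 2)\<close> is not bounded;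
  at size \<open>20\<close> the cruder bound \<open>n\<^sup>2 d (n \<delta>) ^ 20\<close> already tends to zero, and \<open>171\<close> is \<open>19 choose 2\<close>.
\<close>

lemma mnorm_big_excess_le:
  "mnorm E (excess_sum {V \<in> large_subsets. 20 \<le> card V}) \<le> (2 + 2 * real n ^ 2) * (real n * \<delta>) ^ 20"
proof -
  have "mnorm E (excess_sum {V \<in> large_subsets. 20 \<le> card V}) \<le> (\<Sum>V | V \<in> large_subsets \<and> 20 \<le> card V. mnorm E (\<lambda>A. w V * excess (nsets V 2) A))"
    unfolding excess_sum_def[abs_def] by (rule mnorm_sum)
  also have "\<dots> \<le> (\<Sum>V | V \<in> large_subsets \<and> 20 \<le> card V. w V * (2 + 2 * real n ^ 2))"
  proof (rule sum_mono)
    fix V assume "V \<in> {V. V \<in> large_subsets \<and> 20 \<le> card V}"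
    then have V: "V \<subseteq> X" by (auto simp: large_subsets_def)
    have "mnorm E (excess (nsets V 2)) \<le> 2 + 2 * real (card (nsets V 2))"
      by (rule mnorm_excess_le[OF finite_E edges_subset[OF V]])
    also have "card (nsets V 2) \<le> card E"
      by (rule card_mono[OF finite_E edges_subset[OF V]])
    also have "card E \<le> n ^ 2"
      using X by (cases "2 \<le> n") (auto simp: binomial_le_pow binomial_eq_0)
    finally have "mnorm E (excess (nsets V 2)) \<le> 2 + 2 * real n ^ 2" by simp
    then show "mnorm E (\<lambda>A. w V * excess (nsets V 2) A) \<le> w V * (2 + 2 * real n ^ 2)"
      unfolding mnorm_cmult by (auto intro!: mult_mono simp: w_nonneg mnorm_nonneg)
  qed
  also have "\<dots> = (\<Sum>V | V \<in> large_subsets \<and> 20 \<le> card V. w V) * (2 + 2 * real n ^ 2)"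
    by (rule sum_distrib_right[symmetric])
  also have "(\<Sum>V | V \<in> large_subsets \<and> 20 \<le> card V. w V) = (\<Sum>V | V \<subseteq> X \<and> 20 \<le> card V. w V)"
    by (intro sum.cong) (auto simp: large_subsets_def)
  also have "\<dots> * (2 + 2 * real n ^ 2) \<le> (real n * \<delta>) ^ 20 * (2 + 2 * real n ^ 2)"
    by (intro mult_right_mono sum_w_card_ge) auto
  finally show ?thesis by (simp add: mult.commute)
qed

text \<open>Two cliques with at most two common vertices share at most one edge and are
  uncorrelated. All other pairs share a triple \<open>T\<close>; there are at most
  \<open>n ^ 3\<close> triples, and the sets with at least four vertices that contain
  \<open>T\<close> have total weight at most \<open>n * \<delta> ^ 4\<close>, which enters
  squared.\<close>

lemma mnorm_small_excess_le:
  assumes p: "0 < p" "p \<le> 1"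
  shows "mnorm E (\<lambda>A. (1 - p) ^ card (E - A) * excess_sum {V \<in> large_subsets. card V < 20} A) \<le>
    sqrt ((1 / p) ^ 171 * (real n ^ 5 * \<delta> ^ 8))"
proof -
  define J where "J = {V \<in> large_subsets. card V < 20}"
  have finJ: "finite J" using finite_large_subsets by (simp add: J_def)
  have JX: "V \<subseteq> X" "finite V" "card V < 20" if "V \<in> J" for V
    using that X finite_subset by (auto simp: J_def large_subsets_def)
  \<comment> \<open>The correlation of two blocks with \<open>m\<close> common elements, zero for
    \<open>m = 0\<close> and \<open>m = 1\<close>.\<close>
  define K where "K m = (1 / p) ^ m - 1 - real m * (1 / p - 1)" for m
  have K: "w V * w V' * K (card (nsets V 2 \<inter> nsets V' 2)) \<le>
      (1 / p) ^ 171 * (\<Sum>T\<in>nsets X 3. (of_bool (T \<subseteq> V) * w V) * (of_bool (T \<subseteq> V') * w V'))"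
    if V: "V \<in> J" "V' \<in> J" for V V'
  proof -
    have "nsets V 2 \<inter> nsets V' 2 = nsets (V \<inter> V') 2"
      by (auto simp: nsets_def)
    then have m: "card (nsets V 2 \<inter> nsets V' 2) = card (V \<inter> V') choose 2"
      by simp
    have p1: "1 \<le> 1 / p" using p by simp
    show ?thesis
    proof (cases "3 \<le> card (V \<inter> V')")
      case False
      then have "card (V \<inter> V') \<in> {0, 1, 2}" by auto
      then have "K (card (V \<inter> V') choose 2) = 0"
        by (auto simp: K_def binomial_eq_0)
      then show ?thesis unfolding m
        using p by (auto intro!: sum_nonneg mult_nonneg_nonneg simp: w_nonneg)
    next
      case True
      then obtain T where T: "T \<subseteq> V \<inter> V'" "card T = 3" "finite T"
        using obtain_subset_with_card_n by blast
      then have "T \<subseteq> X" using JX(1)[OF V(1)] by blast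
      then have T3: "T \<in> nsets X 3" using T by (auto simp: nsets_def)
      have "card (V \<inter> V') \<le> card V"
        using JX[OF V(1)] by (intro card_mono) auto
      then have "card (V \<inter> V') \<le> 19" using JX(3)[OF V(1)] by linarith
      then have "card (V \<inter> V') * (card (V \<inter> V') - 1) \<le> 19 * 18"
        by (intro mult_le_mono) auto
      then have "card (V \<inter> V') choose 2 \<le> 171"
        unfolding choose_two by (rule order_trans[OF div_le_mono]) simp
      then have "K (card (V \<inter> V') choose 2) \<le> (1 / p) ^ 171"
        unfolding K_def using p1 power_increasing[of "card (V \<inter> V') choose 2" 171 "1 / p"]
          mult_nonneg_nonneg[of "real (card (V \<inter> V') choose 2)" "1 / p - 1"] by linarith
      then have "w V * w V' * K (card (V \<inter> V') choose 2) \<le> w V * w V' * (1 / p) ^ 171"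
        by (intro mult_left_mono mult_nonneg_nonneg w_nonneg)
      also have "w V * w V' \<le> (\<Sum>T\<in>nsets X 3. (of_bool (T \<subseteq> V) * w V) * (of_bool (T \<subseteq> V') * w V'))"
        using member_le_sum[OF T3, of "\<lambda>T. (of_bool (T \<subseteq> V) * w V) * (of_bool (T \<subseteq> V') * w V')"] T X
        by (simp add: w_nonneg finite_imp_finite_nsets)
      finally show ?thesis unfolding m
        using p by (simp add: mult.commute mult_right_mono)
    qed
  qed
  have "mnorm E (\<lambda>A. (1 - p) ^ card (E - A) * excess_sum J A) \<le>
      sqrt (\<Sum>V\<in>J. \<Sum>V'\<in>J. w V * w V' * K (card (nsets V 2 \<inter> nsets V' 2)))"
    unfolding excess_sum_def K_def
    by (rule bernoulli_weights.mnorm_smooth_excess_le[OF bernoulli_weights.intro[OF finite_E p] finJ]) (use JX edges_subset in auto)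
  also have "\<dots> \<le> sqrt ((1 / p) ^ 171 * (real n ^ 5 * \<delta> ^ 8))"
  proof (rule real_sqrt_le_mono)
    have "(\<Sum>V\<in>J. \<Sum>V'\<in>J. w V * w V' * K (card (nsets V 2 \<inter> nsets V' 2))) \<le>
      (\<Sum>V\<in>J. \<Sum>V'\<in>J. (1 / p) ^ 171 * (\<Sum>T\<in>nsets X 3. (of_bool (T \<subseteq> V) * w V) * (of_bool (T \<subseteq> V') * w V')))"
      by (intro sum_mono K)
    also have "\<dots> = (1 / p) ^ 171 * (\<Sum>V\<in>J. \<Sum>V'\<in>J. \<Sum>T\<in>nsets X 3. (of_bool (T \<subseteq> V) * w V) * (of_bool (T \<subseteq> V') * w V'))"
      by (simp only: sum_distrib_left)
    also have "(\<Sum>V\<in>J. \<Sum>V'\<in>J. \<Sum>T\<in>nsets X 3. (of_bool (T \<subseteq> V) * w V) * (of_bool (T \<subseteq> V') * w V')) =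
       (\<Sum>V\<in>J. \<Sum>T\<in>nsets X 3. \<Sum>V'\<in>J. (of_bool (T \<subseteq> V) * w V) * (of_bool (T \<subseteq> V') * w V'))"
      by (intro sum.cong refl sum.swap)
    also have "\<dots> = (\<Sum>T\<in>nsets X 3. \<Sum>V\<in>J. \<Sum>V'\<in>J. (of_bool (T \<subseteq> V) * w V) * (of_bool (T \<subseteq> V') * w V'))"
      by (rule sum.swap)
    also have "\<dots> = (\<Sum>T\<in>nsets X 3. (\<Sum>V\<in>J. of_bool (T \<subseteq> V) * w V)\<^sup>2)"
      by (simp only: power2_eq_square sum_product)
    also have "\<dots> \<le> (\<Sum>T\<in>nsets X 3. (real n * \<delta> ^ 4)\<^sup>2)"
    proof (intro sum_mono power_mono)
      fix T assume T: "T \<in> nsets X 3"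
      have "(\<Sum>V\<in>J. of_bool (T \<subseteq> V) * w V) = (\<Sum>V | V \<in> J \<and> T \<subseteq> V. w V)"
        using finJ by (intro sum.mono_neutral_cong_right) auto
      \<comment> \<open>Large sets have at least four vertices, so they contain the triple strictly;
        this gains the fourth power of \<open>\<delta>\<close>.\<close>
      also have "\<dots> \<le> (\<Sum>V | T \<subset> V \<and> V \<subseteq> X. w V)"
        using X T by (intro sum_mono2) (auto simp: J_def large_subsets_def nsets_def w_nonneg)
      also have "\<dots> \<le> real n * \<delta> ^ (card T + 1)"
        using T by (intro sum_w_superset_strict) (auto simp: nsets_def)
      also have "card T + 1 = 4"
        using T by (simp add: nsets_def)
      finally show "(\<Sum>V\<in>J. of_bool (T \<subseteq> V) * w V) \<le> real n * \<delta> ^ 4" .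
    qed (auto intro!: sum_nonneg simp: w_nonneg)
    also have "\<dots> = real (n choose 3) * (real n * \<delta> ^ 4)\<^sup>2"
      using X by simp
    also have "\<dots> \<le> real n ^ 3 * (real n * \<delta> ^ 4)\<^sup>2"
    proof (intro mult_right_mono)
      have "n choose 3 \<le> n ^ 3"
        by (cases "3 \<le> n") (auto simp: binomial_le_pow binomial_eq_0)
      then show "real (n choose 3) \<le> real n ^ 3"
        by (metis of_nat_le_iff of_nat_power)
    qed auto
    also have "\<dots> = real n ^ 5 * \<delta> ^ 8"
      by (simp add: power_mult_distrib power2_eq_square flip: power_add power_mult)
         (simp add: eval_nat_numeral)
    finally show "(\<Sum>V\<in>J. \<Sum>V'\<in>J. w V * w V' * K (card (nsets V 2 \<inter> nsets V' 2))) \<le> (1 / p) ^ 171 * (real n ^ 5 * \<delta> ^ 8)"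
      using p by (simp add: mult_left_mono)
  qed
  finally show ?thesis unfolding J_def .
qed

text \<open>Double counting of pairs of a large vertex set and an edge inside it that is missing
  from \<open>A\<close>.\<close>

lemma sum_w_card_edges:
  assumes "A \<subseteq> E"
  shows "(\<Sum>V\<in>large_subsets. w V * real (card (nsets V 2 - A))) = \<kappa> * real (card (E - A))"
proof -
  have "(\<Sum>V\<in>large_subsets. w V * real (card (nsets V 2 - A))) = (\<Sum>V\<in>large_subsets. \<Sum>e\<in>E - A. w V * of_bool (e \<subseteq> V))"
  proof (intro sum.cong refl)
    fix V assume "V \<in> large_subsets"
    then have "V \<subseteq> X" by (simp add: large_subsets_def)
    then have "nsets V 2 - A = {e \<in> E - A. e \<subseteq> V}"
      by (auto simp: nsets_def)
    then have "real (card (nsets V 2 - A)) = (\<Sum>e\<in>{e \<in> E - A. e \<subseteq> V}. 1)"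
      by simp
    also have "\<dots> = (\<Sum>e\<in>E - A. of_bool (e \<subseteq> V))"
      using finite_E by (intro sum.mono_neutral_cong_left) auto
    finally show "w V * real (card (nsets V 2 - A)) = (\<Sum>e\<in>E - A. w V * of_bool (e \<subseteq> V))"
      by (simp add: sum_distrib_left)
  qed
  also have "\<dots> = (\<Sum>e\<in>E - A. \<Sum>V\<in>large_subsets. w V * of_bool (e \<subseteq> V))"
    by (rule sum.swap)
  also have "\<dots> = (\<Sum>e\<in>E - A. \<kappa>)"
    by (intro sum.cong refl sum_w_edge) auto
  finally show ?thesis by simp
qed

section \<open>The exponents of the two laws\<close>

definition triangle_prob where "triangle_prob = \<delta> ^ 3 * (1 - \<delta>) ^ (n - 3)"

text \<open>Multiplied by \<open>d\<close>, this is the logarithm of the probability that the random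
  graph with triangles, with the parameters of the theorem, lies in \<open>A\<close>.\<close>

definition log_rgt where
  "log_rgt A = - ((\<delta>\<^sup>2 - (real n - 2) * triangle_prob) * real (card (E - A)))
     - triangle_prob * real (card {t \<in> nsets X 3. \<not> nsets t 2 \<subseteq> A})"

lemma excess_sum_large_subsets:
  assumes "A \<subseteq> E"
  shows "excess_sum large_subsets A = \<kappa> * real (card (E - A)) - (\<Sum>V\<in>large_subsets. w V * of_bool (\<not> nsets V 2 \<subseteq> A))"
  using sum_w_card_edges[OF assms] by (simp add: excess_sum_def excess_def right_diff_distrib sum_subtractf)

text \<open>Split by the number of vertices: cliques on two and on three vertices are edges and
  triangles and occur in \<open>log_rgt\<close> unchanged. The remaining edge rate
  \<open>\<kappa>\<close> in \<open>log_rgt\<close> replaces the larger cliques, and the excess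
  corrects for it.\<close>

lemma log_rgt_plus_excess:
  assumes A: "A \<subseteq> E"
  shows "(\<Sum>V | V \<subseteq> X \<and> 2 \<le> card V. w V * of_bool (\<not> nsets V 2 \<subseteq> A)) = - (log_rgt A + excess_sum large_subsets A)"
proof -
  let ?f = "\<lambda>V. w V * of_bool (\<not> nsets V 2 \<subseteq> A)"
  have fin: "finite E" "finite (nsets X 3)" using X by (auto simp: finite_imp_finite_nsets)
  have "V \<in> {V. V \<subseteq> X \<and> 2 \<le> card V} \<longleftrightarrow> V \<in> E \<union> nsets X 3 \<union> large_subsets" for V
  proof -
    have "finite V" if "V \<subseteq> X" using that X finite_subset by blast
    moreover have "2 \<le> card V \<longleftrightarrow> card V = 2 \<or> card V = 3 \<or> 4 \<le> card V" by linarith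
    ultimately show ?thesis by (auto simp: nsets_def large_subsets_def)
  qed
  then have "{V. V \<subseteq> X \<and> 2 \<le> card V} = E \<union> nsets X 3 \<union> large_subsets" by (rule set_eqI)
  then have "(\<Sum>V | V \<subseteq> X \<and> 2 \<le> card V. ?f V) = (\<Sum>V\<in>E \<union> nsets X 3. ?f V) + (\<Sum>V\<in>large_subsets. ?f V)"
    using fin finite_large_subsets by (simp only:) (intro sum.union_disjoint, auto simp: nsets_def large_subsets_def)
  also have "(\<Sum>V\<in>E \<union> nsets X 3. ?f V) = (\<Sum>V\<in>E. ?f V) + (\<Sum>V\<in>nsets X 3. ?f V)"
    using fin by (intro sum.union_disjoint) (auto simp: nsets_def)
  also have "(\<Sum>V\<in>nsets X 3. ?f V) = (\<Sum>V | V \<in> nsets X 3 \<and> \<not> nsets V 2 \<subseteq> A. triangle_prob)"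
    using fin by (intro sum.mono_neutral_cong_right) (auto simp: w_card triangle_prob_def)
  also have "(\<Sum>V\<in>E. ?f V) = (\<Sum>V\<in>E - A. \<delta>\<^sup>2 * (1 - \<delta>) ^ (n - 2))"
  proof -
    have "nsets e 2 = {e}" if "e \<in> E" for e
      using that by (elim nsets2_E) auto
    then show ?thesis
      using fin by (intro sum.mono_neutral_cong_right) (auto simp: w_card)
  qed
  finally show ?thesis
    unfolding excess_sum_large_subsets[OF A] log_rgt_def \<kappa>_def
    by (simp add: algebra_simps triangle_prob_def)
qed

lemma triangle_prob_nonneg: "0 \<le> triangle_prob"
  using \<delta> by (simp add: triangle_prob_def)

text \<open>This explains the edge probability of the theorem: edges that are cliques by themselves,
  plus the edges replacing large cliques, which is every occurrence of an edge except those in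
  triangles.\<close>

lemma edge_rate_eq: "\<delta>\<^sup>2 - (real n - 2) * triangle_prob = \<delta>\<^sup>2 * (1 - \<delta>) ^ (n - 2) + \<kappa>"
  by (simp add: \<kappa>_def triangle_prob_def mult.assoc)

text \<open>Along the interpolation enough independent edges remain to split off a factor
  \<open>exp (- \<beta> |E - A|)\<close>.\<close>

lemma mpos_interpolation:
  assumes n: "2 \<le> n" and t: "0 \<le> t" "t \<le> 1" and \<beta>: "\<beta> \<le> real d * (\<delta>\<^sup>2 * (1 - \<delta>) ^ (n - 2))"
  shows "mpos E (\<lambda>A. exp (real d * log_rgt A + t * (real d * excess_sum large_subsets A) + \<beta> * real (card (E - A))))"
proof -
  \<comment> \<open>The edge rate left at time \<open>t\<close>: cliques on two vertices in excess
    of \<open>\<beta>\<close>, and the share \<open>1 - t\<close> of the edges that replace large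
    cliques.\<close>
  define c where "c = real d * (\<delta>\<^sup>2 * (1 - \<delta>) ^ (n - 2)) - \<beta> + (1 - t) * (real d * \<kappa>)"
  have c: "0 \<le> c"
    unfolding c_def using \<beta> t \<kappa>_nonneg[OF n] by simp
  have "mpos E (\<lambda>A. exp (- (\<Sum>e\<in>E. c * of_bool (\<not> {e} \<subseteq> A))) *
      exp (- (\<Sum>T\<in>nsets X 3. real d * triangle_prob * of_bool (\<not> nsets T 2 \<subseteq> A))) *
      exp (- (\<Sum>V\<in>large_subsets. t * (real d * w V) * of_bool (\<not> nsets V 2 \<subseteq> A))))" (is "mpos E ?h")
    using c t X triangle_prob_nonneg
    by (intro mpos_mult mpos_exp_superset finite_E finite_large_subsets finite_imp_finite_nsets)
       (auto intro!: mult_nonneg_nonneg w_nonneg)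
  moreover have "?h A = exp (real d * log_rgt A + t * (real d * excess_sum large_subsets A) + \<beta> * real (card (E - A)))"
    if A: "A \<subseteq> E" for A
  proof -
    have 1: "(\<Sum>e\<in>E. c * of_bool (\<not> {e} \<subseteq> A)) = c * real (card (E - A))"
    proof -
      have "(\<Sum>e\<in>E. c * of_bool (\<not> {e} \<subseteq> A)) = (\<Sum>e\<in>E - A. c)"
        using finite_E by (intro sum.mono_neutral_cong_right) auto
      then show ?thesis by simp
    qed
    have 2: "(\<Sum>T\<in>nsets X 3. real d * triangle_prob * of_bool (\<not> nsets T 2 \<subseteq> A)) =
      real d * triangle_prob * real (card {t \<in> nsets X 3. \<not> nsets t 2 \<subseteq> A})"
    proof -
      have "(\<Sum>T\<in>nsets X 3. real d * triangle_prob * of_bool (\<not> nsets T 2 \<subseteq> A)) =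
        (\<Sum>T | T \<in> nsets X 3 \<and> \<not> nsets T 2 \<subseteq> A. real d * triangle_prob)"
        using X by (intro sum.mono_neutral_cong_right) (auto simp: finite_imp_finite_nsets)
      then show ?thesis by simp
    qed
    have 3: "(\<Sum>V\<in>large_subsets. t * (real d * w V) * of_bool (\<not> nsets V 2 \<subseteq> A)) =
      t * (real d * (\<kappa> * real (card (E - A)) - excess_sum large_subsets A))"
      unfolding excess_sum_large_subsets[OF A] by (simp add: sum_distrib_left mult.assoc)
    have rearrange: "- ((D * v - \<beta> + (1 - t) * (D * k)) * a) + - (D * \<tau> * b) + - (t * (D * (k * a - x))) =
      D * (- ((v + k) * a) - \<tau> * b) + t * (D * x) + \<beta> * a" for D v k a b \<tau> x :: real
      by (simp add: algebra_simps)
    show ?thesis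
      unfolding 1 2 3
      unfolding exp_add[symmetric] log_rgt_def edge_rate_eq c_def
      by (rule arg_cong[where f = exp], rule rearrange)
  qed
  ultimately show ?thesis
    by (rule iffD1[OF mpos_cong, rotated])
qed

text \<open>The law at time \<open>t\<close> factors as \<open>Q * R\<close> with \<open>Q\<close>
  an Erdos-Renyi graph. For cliques on fewer than \<open>20\<close> vertices the generator is
  applied to \<open>Q\<close> and estimated in second moment, and \<open>R\<close> has norm one; for
  the others the whole law of norm one is split off and the crude bound is used.\<close>

lemma mnorm_rgt_poisson_le:
  assumes n: "2 \<le> n" and \<beta>: "0 < \<beta>" "\<beta> \<le> real d * (\<delta>\<^sup>2 * (1 - \<delta>) ^ (n - 2))"
  shows "mnorm E (\<lambda>A. exp (real d * log_rgt A + real d * excess_sum large_subsets A) - exp (real d * log_rgt A)) \<le>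
    real d * sqrt ((1 / (1 - exp (- \<beta>))) ^ 171 * (real n ^ 5 * \<delta> ^ 8)) +
    real d * ((2 + 2 * real n ^ 2) * (real n * \<delta>) ^ 20)"
proof (rule mnorm_exp_diff_le[OF finite_E])
  fix t :: real assume t: "0 \<le> t" "t \<le> 1"
  \<comment> \<open>The edge density of a graph whose edges appear independently at rate
    \<open>\<beta>\<close>.\<close>
  define p where "p = 1 - exp (- \<beta>)"
  have p: "0 < p" "p \<le> 1" using \<beta> by (auto simp: p_def)
  define Q where "Q A = (1 - p) ^ card (E - A)" for A
  have Q: "Q A = exp (- (\<beta> * real (card (E - A))))" for A
    by (simp add: Q_def p_def exp_of_nat2_mult[symmetric] mult.commute flip: exp_of_nat_mult)
  define R where "R A = exp (real d * log_rgt A + t * (real d * excess_sum large_subsets A) + \<beta> * real (card (E - A)))" for A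
  define Gs where "Gs = excess_sum {V \<in> large_subsets. card V < 20}"
  define Gb where "Gb = excess_sum {V \<in> large_subsets. 20 \<le> card V}"
  have G: "excess_sum large_subsets A = Gs A + Gb A" for A
  proof -
    have "large_subsets = {V \<in> large_subsets. card V < 20} \<union> {V \<in> large_subsets. 20 \<le> card V}" by auto
    then have "excess_sum large_subsets A = excess_sum ({V \<in> large_subsets. card V < 20} \<union> {V \<in> large_subsets. 20 \<le> card V}) A" by simp
    also have "\<dots> = Gs A + Gb A"
      unfolding excess_sum_def Gs_def Gb_def using finite_large_subsets by (intro sum.union_disjoint) auto
    finally show ?thesis .
  qed
  have Rpos: "mpos E R"
    unfolding R_def by (rule mpos_interpolation[OF n t \<beta>(2)])
  \<comment> \<open>Normalization: at \<open>A = E\<close> all exponents vanish, so \<open>R\<close>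
    and \<open>Q * R\<close> have total mass one.\<close>
  have no_triangle: "{t \<in> nsets X 3. \<not> nsets t 2 \<subseteq> E} = {}"
  proof -
    have "nsets t 2 \<subseteq> E" if "t \<in> nsets X 3" for t
      using that by (intro edges_subset) (simp add: nsets_def)
    then show ?thesis by blast
  qed
  have "log_rgt E = 0"
    unfolding log_rgt_def no_triangle by simp
  moreover have "excess_sum large_subsets E = 0"
  proof -
    have "excess (nsets V 2) E = 0" if "V \<in> large_subsets" for V
    proof -
      have "nsets V 2 \<subseteq> E" using that by (intro edges_subset) (simp add: large_subsets_def)
      moreover from this have "nsets V 2 - E = {}" by blast
      ultimately show ?thesis by (simp only: excess_def) simp
    qed
    then show ?thesis by (simp add: excess_sum_def)
  qed
  ultimately have RE: "R E = 1" by (simp add: R_def)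
  have R1: "mnorm E R = 1"
    using mnorm_mpos[OF finite_E Rpos] RE by simp
  have QR1: "mnorm E (\<lambda>A. Q A * R A) = 1"
  proof -
    have "mpos E (\<lambda>A. exp (- (\<Sum>e\<in>E. \<beta> * of_bool (\<not> {e} \<subseteq> A))))"
      using \<beta> by (intro mpos_exp_superset finite_E) auto
    also have "?this \<longleftrightarrow> mpos E Q"
    proof (rule mpos_cong)
      fix A
      have "(\<Sum>e\<in>E. \<beta> * of_bool (\<not> {e} \<subseteq> A)) = (\<Sum>e\<in>E - A. \<beta>)"
        using finite_E by (intro sum.mono_neutral_cong_right) auto
      then show "exp (- (\<Sum>e\<in>E. \<beta> * of_bool (\<not> {e} \<subseteq> A))) = Q A"
        by (simp add: Q mult.commute)
    qed
    finally have "mpos E (\<lambda>A. Q A * R A)"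
      by (intro mpos_mult finite_E Rpos)
    then show ?thesis
      using mnorm_mpos[OF finite_E] RE by (simp add: Q)
  qed
  have eq: "real d * excess_sum large_subsets A * exp (real d * log_rgt A + t * (real d * excess_sum large_subsets A)) =
    real d * ((Q A * Gs A) * R A) + real d * (Gb A * (Q A * R A))" for A
  proof -
    have "exp (real d * log_rgt A + t * (real d * excess_sum large_subsets A)) = Q A * R A"
      by (simp add: Q R_def flip: exp_add)
    then show ?thesis by (simp add: G algebra_simps)
  qed
  have "mnorm E (\<lambda>A. real d * excess_sum large_subsets A * exp (real d * log_rgt A + t * (real d * excess_sum large_subsets A)))
    \<le> mnorm E (\<lambda>A. real d * ((Q A * Gs A) * R A)) + mnorm E (\<lambda>A. real d * (Gb A * (Q A * R A)))"
    unfolding eq by (rule mnorm_add)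
  also have "\<dots> \<le> real d * (mnorm E (\<lambda>A. Q A * Gs A) * 1) + real d * (mnorm E Gb * 1)"
    unfolding mnorm_cmult
    using mnorm_mult[OF finite_E, of "\<lambda>A. Q A * Gs A" R] mnorm_mult[OF finite_E, of Gb "\<lambda>A. Q A * R A"] R1 QR1
    by (intro add_mono) (auto intro!: mult_left_mono)
  also have "\<dots> \<le> real d * sqrt ((1 / p) ^ 171 * (real n ^ 5 * \<delta> ^ 8)) + real d * ((2 + 2 * real n ^ 2) * (real n * \<delta>) ^ 20)"
    using mnorm_small_excess_le[OF p] mnorm_big_excess_le
    unfolding Q_def Gs_def Gb_def mult_1_right
    by (intro add_mono mult_left_mono) auto
  finally show "mnorm E (\<lambda>A. real d * excess_sum large_subsets A * exp (real d * log_rgt A + t * (real d * excess_sum large_subsets A))) \<le>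
    real d * sqrt ((1 / (1 - exp (- \<beta>))) ^ 171 * (real n ^ 5 * \<delta> ^ 8)) + real d * ((2 + 2 * real n ^ 2) * (real n * \<delta>) ^ 20)"
    unfolding p_def .
qed

text \<open>Poissonization of the number of cliques, followed by the exchange of the large ones for
  independent edges.\<close>

lemma mnorm_rig_rgt_le:
  assumes n: "2 \<le> n" and d: "0 < d" and \<epsilon>: "0 < \<epsilon>" "\<epsilon> < 1"
    and \<beta>: "0 < \<beta>" "\<beta> \<le> real d * (\<delta>\<^sup>2 * (1 - \<delta>) ^ (n - 2))"
  shows "mnorm E (\<lambda>A. (\<Sum>V\<in>Pow X. w V * of_bool (nsets V 2 \<subseteq> A)) ^ d - exp (real d * log_rgt A)) \<le>
    2 * \<epsilon> + 2 * ((real n * \<delta>)\<^sup>2 / \<epsilon>) +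
    (real d * sqrt ((1 / (1 - exp (- \<beta>))) ^ 171 * (real n ^ 5 * \<delta> ^ 8)) +
     real d * ((2 + 2 * real n ^ 2) * (real n * \<delta>) ^ 20))"
proof -
  \<comment> \<open>The vertex sets that produce at least one edge; all others leave the graph
    unchanged.\<close>
  define J where "J = {V. V \<subseteq> X \<and> 2 \<le> card V}"
  define r where "r A = (\<Sum>V\<in>J. w V * of_bool (nsets V 2 \<subseteq> A))" for A
  define q where "q = (\<Sum>V\<in>J. w V)"
  have J: "finite J" "J \<subseteq> Pow X" using X by (auto simp: J_def)
  have rpos: "mpos E r"
    unfolding r_def by (intro mpos_sum mpos_cmult mpos_superset finite_E w_nonneg)
  have rE: "r E = q"
    unfolding r_def q_def by (intro sum.cong refl) (use edges_subset in \<open>auto simp: J_def\<close>)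
  have q: "q \<le> (real n * \<delta>)\<^sup>2"
    unfolding q_def J_def by (rule sum_w_card_ge)
  have q1: "q \<le> 1"
    unfolding q_def sum_w[symmetric] using X J by (intro sum_mono2) (auto simp: w_nonneg)
  have \<mu>: "(\<Sum>V\<in>Pow X. w V * of_bool (nsets V 2 \<subseteq> A)) = 1 - q + r A" for A
  proof -
    have "(\<Sum>V\<in>Pow X. w V * of_bool (nsets V 2 \<subseteq> A)) = (\<Sum>V\<in>Pow X - J. w V * of_bool (nsets V 2 \<subseteq> A)) + r A"
      unfolding r_def using X J by (intro sum.subset_diff) auto
    also have "(\<Sum>V\<in>Pow X - J. w V * of_bool (nsets V 2 \<subseteq> A)) = (\<Sum>V\<in>Pow X - J. w V)"
    proof (intro sum.cong refl)
      fix V assume V: "V \<in> Pow X - J"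
      then have "finite V" "card V < 2" using X finite_subset by (auto simp: J_def)
      then have "nsets V 2 = {}" using nsets_eq_empty_iff by metis
      then show "w V * of_bool (nsets V 2 \<subseteq> A) = w V" by simp
    qed
    also have "(\<Sum>V\<in>Pow X - J. w V) = 1 - q"
      using sum.subset_diff[OF J(2), of w] sum_w X by (simp add: q_def)
    finally show ?thesis .
  qed
  have exp_eq: "real d * (r A - q) = real d * log_rgt A + real d * excess_sum large_subsets A" if "A \<subseteq> E" for A
  proof -
    have "q - r A = (\<Sum>V\<in>J. w V * of_bool (\<not> nsets V 2 \<subseteq> A))"
      unfolding q_def r_def sum_subtractf[symmetric] by (intro sum.cong refl) auto
    also have "\<dots> = - (log_rgt A + excess_sum large_subsets A)"
      unfolding J_def by (rule log_rgt_plus_excess[OF that])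
    finally have "r A - q = log_rgt A + excess_sum large_subsets A" by simp
    then show ?thesis by (simp add: distrib_left)
  qed
  have "mnorm E (\<lambda>A. (\<Sum>V\<in>Pow X. w V * of_bool (nsets V 2 \<subseteq> A)) ^ d - exp (real d * log_rgt A)) =
    mnorm E (\<lambda>A. ((1 - q + r A) ^ d - exp (real d * (r A - q))) +
      (exp (real d * log_rgt A + real d * excess_sum large_subsets A) - exp (real d * log_rgt A)))"
    by (rule mnorm_cong) (simp add: \<mu> exp_eq)
  also have "\<dots> \<le> mnorm E (\<lambda>A. (1 - q + r A) ^ d - exp (real d * (r A - q))) +
    mnorm E (\<lambda>A. exp (real d * log_rgt A + real d * excess_sum large_subsets A) - exp (real d * log_rgt A))"
    by (rule mnorm_add)
  also have "mnorm E (\<lambda>A. (1 - q + r A) ^ d - exp (real d * (r A - q))) \<le> 2 * \<epsilon> + 2 * (q / \<epsilon>)"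
    by (rule mnorm_poissonization[OF finite_E rpos rE q1 \<epsilon> d])
  also have "q / \<epsilon> \<le> (real n * \<delta>)\<^sup>2 / \<epsilon>"
    using q \<epsilon> by (intro divide_right_mono) auto
  also note mnorm_rgt_poisson_le[OF n \<beta>]
  finally show ?thesis by simp
qed

end

section \<open>The limit\<close>

lemma tv_dist_RIG_RGT_le:
  assumes n: "2 \<le> n" and d: "0 < d" and delta: "0 < \<delta>" "\<delta> \<le> 1" and small: "real n * \<delta> < 1"
    and \<beta>: "0 < \<beta>" "\<beta> \<le> real d * (\<delta>\<^sup>2 * (1 - \<delta>) ^ (n - 2))"
  shows "tv_dist (RIG n d \<delta>)
      (RGT n (1 - exp (- (real d * \<delta>\<^sup>2) + (real n - 2) * real d * \<delta> ^ 3 * (1 - \<delta>) ^ (n - 3)))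
        (1 - exp (- (real d * \<delta> ^ 3 * (1 - \<delta>) ^ (n - 3)))))
    \<le> 4 * (real n * \<delta>) + (real d * sqrt ((1 / (1 - exp (- \<beta>))) ^ 171 * (real n ^ 5 * \<delta> ^ 8)) +
     real d * ((2 + 2 * real n ^ 2) * (real n * \<delta>) ^ 20))"
proof -
  interpret random_subset_weights "{1..n}" n \<delta>
    by standard (use delta in auto)
  define rate2 where "rate2 = real d * (\<delta>\<^sup>2 - (real n - 2) * triangle_prob)"
  define rate3 where "rate3 = real d * triangle_prob"
  have "- (real d * \<delta>\<^sup>2) + (real n - 2) * real d * \<delta> ^ 3 * (1 - \<delta>) ^ (n - 3) = - rate2"
    by (simp add: rate2_def triangle_prob_def algebra_simps)
  moreover have "real d * \<delta> ^ 3 * (1 - \<delta>) ^ (n - 3) = rate3"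
    by (simp add: rate3_def triangle_prob_def)
  moreover have rates: "0 \<le> rate2" "0 \<le> rate3"
    unfolding rate2_def rate3_def edge_rate_eq using \<kappa>_nonneg[OF n] triangle_prob_nonneg \<delta> by auto
  ultimately have RGT: "measure_pmf.prob (RGT n (1 - exp (- (real d * \<delta>\<^sup>2) + (real n - 2) * real d * \<delta> ^ 3 * (1 - \<delta>) ^ (n - 3)))
        (1 - exp (- (real d * \<delta> ^ 3 * (1 - \<delta>) ^ (n - 3))))) (Pow A) = exp (real d * log_rgt A)" if "A \<subseteq> E" for A
  proof -
    have "measure_pmf.prob (RGT n (1 - exp (- rate2)) (1 - exp (- rate3))) (Pow A) =
      exp (- rate2) ^ card (E - A) * exp (- rate3) ^ card {t \<in> nsets {1..n} 3. \<not> nsets t 2 \<subseteq> A}"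
      using RGT_subset[OF that, of "1 - exp (- rate2)" "1 - exp (- rate3)"] rates by simp
    also have "\<dots> = exp (real d * log_rgt A)"
      unfolding exp_of_nat_mult[symmetric] exp_add[symmetric] log_rgt_def rate2_def rate3_def
      by (rule arg_cong[where f = exp]) (simp add: algebra_simps)
    finally show ?thesis
      unfolding \<open>- (real d * \<delta>\<^sup>2) + (real n - 2) * real d * \<delta> ^ 3 * (1 - \<delta>) ^ (n - 3) = - rate2\<close>
        \<open>real d * \<delta> ^ 3 * (1 - \<delta>) ^ (n - 3) = rate3\<close> .
  qed
  have "tv_dist (RIG n d \<delta>)
      (RGT n (1 - exp (- (real d * \<delta>\<^sup>2) + (real n - 2) * real d * \<delta> ^ 3 * (1 - \<delta>) ^ (n - 3)))
        (1 - exp (- (real d * \<delta> ^ 3 * (1 - \<delta>) ^ (n - 3))))) \<le>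
    mnorm E (\<lambda>A. measure_pmf.prob (RIG n d \<delta>) (Pow A) - measure_pmf.prob
      (RGT n (1 - exp (- (real d * \<delta>\<^sup>2) + (real n - 2) * real d * \<delta> ^ 3 * (1 - \<delta>) ^ (n - 3)))
        (1 - exp (- (real d * \<delta> ^ 3 * (1 - \<delta>) ^ (n - 3))))) (Pow A))"
    by (intro tv_dist_le_mnorm finite_E set_RIG set_RGT)
  also have "\<dots> = mnorm E (\<lambda>A. (\<Sum>V\<in>Pow {1..n}. w V * of_bool (nsets V 2 \<subseteq> A)) ^ d - exp (real d * log_rgt A))"
    using delta by (intro mnorm_cong) (simp only: RGT RIG_subset less_imp_le subset_prob_def)
  \<comment> \<open>The choice \<open>\<epsilon> = n * \<delta>\<close> balances the two terms of
    the Poissonization error.\<close>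
  also have "\<dots> \<le> 2 * (real n * \<delta>) + 2 * ((real n * \<delta>)\<^sup>2 / (real n * \<delta>)) +
    (real d * sqrt ((1 / (1 - exp (- \<beta>))) ^ 171 * (real n ^ 5 * \<delta> ^ 8)) +
     real d * ((2 + 2 * real n ^ 2) * (real n * \<delta>) ^ 20))"
    using n d delta small \<beta> by (intro mnorm_rig_rgt_le) auto
  also have "(real n * \<delta>)\<^sup>2 / (real n * \<delta>) = real n * \<delta>"
    by (simp add: power2_eq_square)
  finally show ?thesis by linarith
qed

text \<open>Since \<open>z\<close> is the square of \<open>n ^ (5 / 2) / d\<close>, it remains to
  bound every error term by a power of \<open>z\<close>.\<close>

lemma tv_dist_RIG_RGT_le_constant_density:
  fixes n d :: nat and \<delta> c\<^sub>1 c\<^sub>2 :: real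
  defines "z \<equiv> real n ^ 5 / real d ^ 2"
  assumes n: "2 \<le> n" and d: "0 < d" and \<delta>: "0 < \<delta>" "\<delta> \<le> 1"
    and c: "0 < c\<^sub>1" "c\<^sub>1 \<le> real d * \<delta>\<^sup>2" "real d * \<delta>\<^sup>2 \<le> c\<^sub>2"
    and z: "sqrt (c\<^sub>2 * sqrt z) \<le> 1 / 2"
  shows "tv_dist (RIG n d \<delta>)
      (RGT n (1 - exp (- (real d * \<delta>\<^sup>2) + (real n - 2) * real d * \<delta> ^ 3 * (1 - \<delta>) ^ (n - 3)))
        (1 - exp (- (real d * \<delta> ^ 3 * (1 - \<delta>) ^ (n - 3)))))
    \<le> 4 * sqrt (c\<^sub>2 * sqrt z) + (sqrt ((1 / (1 - exp (- (c\<^sub>1 / 2)))) ^ 171 * (c\<^sub>2 ^ 4 * z)) + 4 * (c\<^sub>2 ^ 10 * sqrt (z ^ 9)))"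
proof -
  have pos: "0 < real n" "0 < real d" using n d by auto
  have c0: "0 < c\<^sub>2" using c by linarith
  have n\<delta>: "real n * \<delta> \<le> sqrt (c\<^sub>2 * sqrt z)"
  proof (rule real_le_rsqrt)
    have "(real n * \<delta>)\<^sup>2 = (real d * \<delta>\<^sup>2) * (real n ^ 2 / real d)"
      using pos by (simp add: power_mult_distrib)
    also have "\<dots> \<le> c\<^sub>2 * (real n ^ 2 / real d)"
      using c by (intro mult_right_mono) auto
    also have "real n ^ 2 / real d \<le> sqrt z"
    proof (rule real_le_rsqrt)
      have "(real n ^ 2 / real d)\<^sup>2 = real n ^ 4 / real d ^ 2"
        by (simp add: power_divide flip: power_mult)
      also have "\<dots> \<le> z"
        unfolding z_def using n by (intro divide_right_mono power_increasing) auto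
      finally show "(real n ^ 2 / real d)\<^sup>2 \<le> z" .
    qed
    finally show "(real n * \<delta>)\<^sup>2 \<le> c\<^sub>2 * sqrt z" using c0 by simp
  qed
  have \<beta>: "c\<^sub>1 / 2 \<le> real d * (\<delta>\<^sup>2 * (1 - \<delta>) ^ (n - 2))"
  proof -
    \<comment> \<open>Bernoulli's inequality: as \<open>n * \<delta> \<le> 1 / 2\<close>, at least
      half of \<open>d * \<delta> ^ 2\<close> comes from cliques on exactly two vertices, hence
      \<open>\<beta> = c\<^sub>1 / 2\<close>.\<close>
    have "1 / 2 \<le> 1 + real (n - 2) * (- \<delta>)"
    proof -
      have "real (n - 2) * \<delta> \<le> real n * \<delta>" using \<delta> by (intro mult_right_mono) auto
      then show ?thesis using n\<delta> z by simp
    qed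
    also have "\<dots> \<le> (1 + (- \<delta>)) ^ (n - 2)"
      using \<delta> by (intro Bernoulli_inequality) auto
    finally have "c\<^sub>1 * (1 / 2) \<le> (real d * \<delta>\<^sup>2) * (1 - \<delta>) ^ (n - 2)"
      using c \<delta> by (intro mult_mono) auto
    then show ?thesis by (simp add: mult.assoc)
  qed
  have P: "0 \<le> (1 / (1 - exp (- (c\<^sub>1 / 2)))) ^ 171"
    using c by (intro zero_le_power) auto
  have "real d * sqrt ((1 / (1 - exp (- (c\<^sub>1 / 2)))) ^ 171 * (real n ^ 5 * \<delta> ^ 8)) =
    sqrt ((1 / (1 - exp (- (c\<^sub>1 / 2)))) ^ 171 * (real d ^ 2 * (real n ^ 5 * \<delta> ^ 8)))"
    by (simp add: real_sqrt_mult)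
  \<comment> \<open>Here the threshold for \<open>d\<close> appears: at constant density the squared
    second moment bound is of order \<open>n ^ 5 / d ^ 2\<close>.\<close>
  also have "real d ^ 2 * (real n ^ 5 * \<delta> ^ 8) = (real d * \<delta>\<^sup>2) ^ 4 * z"
    using pos by (simp add: z_def power_mult_distrib field_simps flip: power_mult power_add)
  also have "sqrt ((1 / (1 - exp (- (c\<^sub>1 / 2)))) ^ 171 * ((real d * \<delta>\<^sup>2) ^ 4 * z)) \<le>
    sqrt ((1 / (1 - exp (- (c\<^sub>1 / 2)))) ^ 171 * (c\<^sub>2 ^ 4 * z))"
    using c by (intro real_sqrt_le_mono mult_left_mono mult_right_mono power_mono P) (auto simp: z_def)
  finally have small: "real d * sqrt ((1 / (1 - exp (- (c\<^sub>1 / 2)))) ^ 171 * (real n ^ 5 * \<delta> ^ 8)) \<le>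
    sqrt ((1 / (1 - exp (- (c\<^sub>1 / 2)))) ^ 171 * (c\<^sub>2 ^ 4 * z))" .
  have big: "real d * ((2 + 2 * real n ^ 2) * (real n * \<delta>) ^ 20) \<le> 4 * (c\<^sub>2 ^ 10 * sqrt (z ^ 9))"
  proof -
    have "2 + 2 * real n ^ 2 \<le> 4 * real n ^ 2"
      using n one_le_power[of "real n" 2] by simp
    then have "real d * ((2 + 2 * real n ^ 2) * (real n * \<delta>) ^ 20) \<le> real d * ((4 * real n ^ 2) * (real n * \<delta>) ^ 20)"
      using \<delta> by (intro mult_left_mono mult_right_mono) auto
    also have "\<dots> = 4 * ((real d * \<delta>\<^sup>2) ^ 10 * (real n ^ 22 / real d ^ 9))"
      using pos by (simp add: power_mult_distrib field_simps flip: power_mult power_add power_Suc power_Suc2)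
    also have "\<dots> \<le> 4 * (c\<^sub>2 ^ 10 * (real n ^ 22 / real d ^ 9))"
      using c by (intro mult_left_mono mult_right_mono power_mono) auto
    \<comment> \<open>Half a power of \<open>n\<close> is to spare, as \<open>sqrt (z ^ 9)\<close>
      is \<open>n ^ (45 / 2) / d ^ 9\<close>.\<close>
    also have "real n ^ 22 / real d ^ 9 \<le> sqrt (z ^ 9)"
    proof (rule real_le_rsqrt)
      have "(real n ^ 22 / real d ^ 9)\<^sup>2 = real n ^ 44 / real d ^ 18"
        by (simp add: power_divide flip: power_mult)
      also have "\<dots> \<le> real n ^ 45 / real d ^ 18"
        using n by (intro divide_right_mono power_increasing) auto
      also have "\<dots> = z ^ 9"
        by (simp add: z_def power_divide flip: power_mult)
      finally show "(real n ^ 22 / real d ^ 9)\<^sup>2 \<le> z ^ 9" .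
    qed
    finally show ?thesis using c0 by simp
  qed
  have "real n * \<delta> < 1" using n\<delta> z by linarith
  from tv_dist_RIG_RGT_le[OF n d \<delta> this _ \<beta>] n\<delta> small big c show ?thesis
    by linarith
qed

theorem theorem1p3:
  fixes d :: "nat \<Rightarrow> nat" and \<delta> :: "nat \<Rightarrow> real"
  assumes prob: "\<And>n. 0 \<le> \<delta> n \<and> \<delta> n \<le> 1"
    and density: "(\<lambda>n. real (d n)) \<in> \<Theta>(\<lambda>n. 1 / (\<delta> n)\<^sup>2)"
    and large: "filterlim (\<lambda>n. real (d n) / real n powr (5 / 2)) at_top sequentially"
  shows "(\<lambda>n. tv_dist (RIG n (d n) (\<delta> n))
            (RGT n
              (1 - exp (- (real (d n) * (\<delta> n)\<^sup>2)
                        + (real n - 2) * real (d n) * \<delta> n ^ 3 * (1 - \<delta> n) ^ (n - 3)))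
              (1 - exp (- (real (d n) * \<delta> n ^ 3 * (1 - \<delta> n) ^ (n - 3))))))
         \<in> o(\<lambda>_. 1)"
proof -
  \<comment> \<open>Once \<open>\<delta> n\<close> is known to be nonzero, the two constants confine
    \<open>d n * (\<delta> n) ^ 2\<close> to the interval from \<open>c\<^sub>1\<close> to
    \<open>c\<^sub>2\<close> for large \<open>n\<close>.\<close>
  obtain c\<^sub>2 where c2: "c\<^sub>2 > 0" "\<forall>\<^sub>F n in sequentially. norm (real (d n)) \<le> c\<^sub>2 * norm (1 / (\<delta> n)\<^sup>2)"
    using bigthetaD1[OF density] by (rule landau_o.bigE)
  obtain c\<^sub>1 where c1: "c\<^sub>1 > 0" "\<forall>\<^sub>F n in sequentially. c\<^sub>1 * norm (1 / (\<delta> n)\<^sup>2) \<le> norm (real (d n))"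
    using bigthetaD2[OF density] by (rule landau_omega.bigE)
  define z where "z n = real n ^ 5 / real (d n) ^ 2" for n
  define B where "B n = 4 * sqrt (c\<^sub>2 * sqrt (z n)) + (sqrt ((1 / (1 - exp (- (c\<^sub>1 / 2)))) ^ 171 * (c\<^sub>2 ^ 4 * z n)) + 4 * (c\<^sub>2 ^ 10 * sqrt (z n ^ 9)))" for n
  \<comment> \<open>For positive \<open>n\<close>, \<open>z n\<close> is the inverse square of the
    quotient that tends to infinity.\<close>
  have z0: "z \<longlonglongrightarrow> 0"
  proof -
    have "((\<lambda>n. inverse (real (d n) / real n powr (5 / 2))) \<longlongrightarrow> 0) sequentially"
      by (rule tendsto_inverse_0_at_top[OF large])
    then have "((\<lambda>n. (inverse (real (d n) / real n powr (5 / 2))) ^ 2) \<longlongrightarrow> 0 ^ 2) sequentially"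
      by (rule tendsto_power)
    moreover have "\<forall>\<^sub>F n in sequentially. (inverse (real (d n) / real n powr (5 / 2))) ^ 2 = z n"
      using eventually_gt_at_top[of 0]
    proof eventually_elim
      case (elim n)
      have "(real n powr (5 / 2)) ^ 2 = real n powr 5"
        by (simp add: power2_eq_square flip: powr_add)
      also have "\<dots> = real n ^ 5"
        using elim by simp
      finally show ?case by (simp add: z_def power_divide)
    qed
    ultimately have "z \<longlonglongrightarrow> 0 ^ 2"
      by (rule Lim_transform_eventually)
    then show ?thesis by simp
  qed
  have B0: "B \<longlonglongrightarrow> 0"
  proof -
    have "B \<longlonglongrightarrow> 4 * sqrt (c\<^sub>2 * sqrt 0) + (sqrt ((1 / (1 - exp (- (c\<^sub>1 / 2)))) ^ 171 * (c\<^sub>2 ^ 4 * 0)) + 4 * (c\<^sub>2 ^ 10 * sqrt (0 ^ 9)))"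
      unfolding B_def by (intro tendsto_intros z0)
    then show ?thesis by simp
  qed
  have "(\<lambda>n. sqrt (c\<^sub>2 * sqrt (z n))) \<longlonglongrightarrow> sqrt (c\<^sub>2 * sqrt 0)"
    by (intro tendsto_intros z0)
  then have "\<forall>\<^sub>F n in sequentially. sqrt (c\<^sub>2 * sqrt (z n)) < 1 / 2"
    by (rule order_tendstoD) simp
  moreover have "\<forall>\<^sub>F n in sequentially. 1 \<le> real (d n) / real n powr (5 / 2)"
    using large by (simp add: filterlim_at_top)
  ultimately have "\<forall>\<^sub>F n in sequentially. tv_dist (RIG n (d n) (\<delta> n))
            (RGT n
              (1 - exp (- (real (d n) * (\<delta> n)\<^sup>2)
                        + (real n - 2) * real (d n) * \<delta> n ^ 3 * (1 - \<delta> n) ^ (n - 3)))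
              (1 - exp (- (real (d n) * \<delta> n ^ 3 * (1 - \<delta> n) ^ (n - 3))))) \<le> B n"
    using c1(2) c2(2) eventually_ge_at_top[of 2]
  proof eventually_elim
    case (elim n)
    \<comment> \<open>\<open>d n\<close> is positive because the quotient is at least
      \<open>1\<close>; then \<open>\<delta> n\<close> is nonzero, since \<open>1 / 0 = 0\<close> in
      the upper bound would force \<open>d n = 0\<close>.\<close>
    have d: "0 < d n" using elim(2) by (cases "d n") auto
    have "\<delta> n \<noteq> 0" using elim(4) d by auto
    then have \<delta>: "0 < \<delta> n" "\<delta> n \<le> 1" using prob[of n] by auto
    show ?case
      unfolding B_def z_def
      using elim \<delta> d c1(1)
      by (intro tv_dist_RIG_RGT_le_constant_density) (auto simp: field_simps z_def)
  qed
  then have "(\<lambda>n. tv_dist (RIG n (d n) (\<delta> n))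
            (RGT n
              (1 - exp (- (real (d n) * (\<delta> n)\<^sup>2)
                        + (real n - 2) * real (d n) * \<delta> n ^ 3 * (1 - \<delta> n) ^ (n - 3)))
              (1 - exp (- (real (d n) * \<delta> n ^ 3 * (1 - \<delta> n) ^ (n - 3)))))) \<longlonglongrightarrow> 0"
    by (rule tendsto_sandwich[OF always_eventually _ tendsto_const B0, rotated]) (simp add: tv_dist_nonneg)
  then show ?thesis
    by (intro smalloI_tendsto) simp_all
qed

end
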